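(* Let $G=(O\cup L,\,D_O\cup D_L)$ be an acyclic process graph with exogenous latent structure, let $v\in O$ be an observed process, and suppose that the triple $(Y,W,L')$, with $Y,W\subset O\setminus\{v\}$ and $L'\subset L$, satisfies the latent factor half-trek criterion (LF-HTC) with respect to $v$. If all links $u\to y\in D_O$ (with $u,y\in O$) such that $y\in W\cup\big(Y\cap\mathrm{htr}_{L'}(W\cup\{v\})\big)$ are rationally identifiable, then all links $x\to v$ with $x\in\mathrm{pa}_O(v)$ are rationally identifiable, i.e. all link functions $h_{x,v}$, $x\in \mathrm{pa}_O(v)$, are rationally identifiable.
   Context: **Graphs.** Let $V=O\cup L$ be a finite set, $O\cap L=\emptyset$ (observed and latent process indices). A (stationary) time series graph over $V$ is a directed graph $\mathcal G=(V\times\mathbb Z,\mathcal D)$ such that whenever $(v(t-k),w(t))\in\mathcal D$ (an edge from $(v,t-k)$ to $(w,t)$), then $k\ge 0$ and $(v(s-k),w(s))\in\mathcal D$ for all $s\in\mathbb Z$; this is written $v\to_k w$. All time series graphs have finite order, i.e. $\max\{k:v\to_k w\}<\infty$. Auto-lags $v\to_k v$ are allowed. The process graph $G=(V,D)$ of $\mathcal G$ has the edge $v\to w$ ($v\neq w$) iff $v\to_k w$ for some $k\ge 0$ (auto-lags do not count as edges of $G$). $D=D_O\cup D_L$, where $D_O$ (resp. $D_L$) are the edges starting at an observed (resp. latent) process. Exogenous latent structure: no $l\in L$ has an incoming edge on $G$. $\mathcal T(G)$ is the set of all time series graphs with process graph $G$. $\mathrm{pa}_O(v)$, $\mathrm{pa}_L(v)$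 are the observed, latent parents of $v$ in $G$; for a set $S$, $\mathrm{pa}_L(S)=\bigcup_{s\in S}\mathrm{pa}_L(s)$. **Parameters.** $\mathbb R^{\mathcal D}$ is the finite-dimensional space of families $\Phi=(\phi_{v,w}(k))_{v\to_k w}$; $\mathbb R^{\mathcal D}_{\mathrm{stb}}$ is the set of $\Phi$ with $\sum_k|\phi_{v,v}(k)|<1$ for all $v\in V$ and $\sum_{v,w\in O}\sum_{k:v\to_k w}|\phi_{v,w}(k)|<1$. $\mathbb R^{\mathcal G}_{\mathrm{stb}}=\mathbb R^{\mathcal D}_{\mathrm{stb}}\times\mathbb R^V_+$, where $\mathbb R^V_+$ is the set of diagonal matrices $\Omega=\mathrm{diag}((\omega_v)_{v\in V})$, $\omega_v>0$. **Spectrum.** For $r\in\mathbb R(z)$ put $r^*(z)=r(z^{-1})$; apply $*$ entrywise to matrices. $\varphi_{x,y}(z)=\sum_{k:x\to_k y}\phi_{x,y}(k)z^k$. $H\in\mathbb R(z)^{V\times V}$ has entries (link functions) $h_{v,w}=\varphi_{v,w}/(1-\varphi_{w,w})$ if $v\to w$ in $G$, and $0$ otherwise. $\mathcal S^{\mathrm I}$ is diagonal with entries $\mathcal S^{\mathrm I}_v=\omega_v(1-\varphi_{v,v})^{-1}\left((1-\varphi_{v,v})^{-1}\right)^*$. With $[M]_{A,B}$ the submatrix with rows $A$, columns $B$, the projected internal spectrum is $\mathcal S^{\mathrm{LI}}=[\mathcal S^{\mathrm I}]_{O,O}+[H]_{L,O}^\top[\mathcal S^{\mathrm I}]_{L,L}[H]_{L,O}^*$,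 and the spectrum of the observed processes is $\mathcal S_{\mathcal G}(\Phi,\Omega)=(I-[H]_{O,O})^{-\top}\,\mathcal S^{\mathrm{LI}}\,(I-[H]_{O,O}^* )^{-1}\in\mathbb R(z)^{O\times O}$. **Rational identifiability.** A link $v\to w$ of $G$ with $v,w\in O$ is rationally identifiable if there is a rational function $\psi_{v,w}$ (a fixed expression built by addition, multiplication and division from the entries of an $O\times O$ matrix over $\mathbb R(z)$, depending only on $G$ and not on the time series graph) and, for every $\mathcal G\in\mathcal T(G)$, a proper algebraic subset $A_{\mathcal G}\subset\overline{\mathbb R^{\mathcal G}_{\mathrm{stb}}}$ (proper subset cut out by polynomial equations in the parameters) such that for all $(\Phi,\Omega)\in\mathbb R^{\mathcal G}_{\mathrm{stb}}\setminus A_{\mathcal G}$, $\psi_{v,w}$ is defined at $\mathcal S_{\mathcal G}(\Phi,\Omega)$ and $\psi_{v,w}(\mathcal S_{\mathcal G}(\Phi,\Omega))=h_{v,w}(\Phi)$ in $\mathbb R(z)$. **Half-treks.** A trek from $v$ to $w$ is a triple $(\mathrm{Left},\mathrm{top},\mathrm{Right})$ of a vertex $\mathrm{top}$, a directed path $\mathrm{Left}$ from $\mathrm{top}$ to $v$, and a directed path $\mathrm{Right}$ from $\mathrm{top}$ to $w$. A latent factor half-trek from $v\in O$ to $w\in O$ is a trek of the form $v\leftarrow l\to x_1\to\cdots\to x_n\to w$ or $v\to x_1\to\cdots\to x_n\to w$ with $l\in L$, $x_i\in O$, $n\ge0$; the trivial trek consisting of the single vertex $v=w$ is also allowed. For $L'\subset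 L$, $\mathrm{htr}_{L'}(v)$ is the set of $w\in O$ for which there is a latent factor half-trek from $v$ to $w$ not passing through any node of $L'$; $\mathrm{htr}_{L'}(X)=\bigcup_{x\in X}\mathrm{htr}_{L'}(x)$. A system of treks from $A$ to $B$ ($|A|=|B|$) is a family of $|A|$ treks whose initial points are the distinct elements of $A$ and whose end points are the distinct elements of $B$; it has no sided intersection if the Left paths are pairwise vertex-disjoint and the Right paths are pairwise vertex-disjoint. **LF-HTC.** $(Y,W,L')$ with $Y,W\subset O\setminus\{v\}$, $L'\subset L$ satisfies the LF-HTC with respect to $v\in O$ if: (1) $|Y|=|\mathrm{pa}_O(v)|+|L'|$ and $|W|=|L'|$ with $W\cap\mathrm{pa}_O(v)=\emptyset$; (2) $Y\cap W=\emptyset$ and $\mathrm{pa}_L(Y)\cap\mathrm{pa}_L(W\cup\{v\})\subset L'$; (3) there is a system of latent factor half-treks from $Y$ to $\mathrm{pa}_O(v)\cup W$ with no sided intersection such that every half-trek in it ending at some $w\in W$ has the form $y\leftarrow l\to w$ with $y\in Y$, $l\in L'$. *)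

theory Defs
  imports "HOL-Analysis.Analysis" "HOL-Computational_Algebra.Computational_Algebra"
begin

section \<open>Process graphs and time series graphs\<close>

text \<open>The vertex set is the finite type \<open>'v\<close>; it is partitioned into \<open>Ob\<close> (observed processes)
  and \<open>La\<close> (latent processes), either of which may be any subset of \<open>'v\<close>.\<close>

definition exogenous_latent_graph ::
    "'v::finite set \<Rightarrow> 'v set \<Rightarrow> ('v \<times> 'v) set \<Rightarrow> bool" where
  "exogenous_latent_graph Ob La D \<longleftrightarrow>
     Ob \<union> La = UNIV \<and> Ob \<inter> La = {} \<and> irrefl D \<and> (\<forall>u. \<forall>l\<in>La. (u, l) \<notin> D)"

definition parents_in :: "('v \<times> 'v) set \<Rightarrow> 'v set \<Rightarrow> 'v set \<Rightarrow> 'v set" where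
  "parents_in D A S = {u \<in> A. \<exists>s\<in>S. (u, s) \<in> D}"

type_synonym 'v ts_edges = "(('v \<times> int) \<times> ('v \<times> int)) set"

definition lagged_edge :: "'v ts_edges \<Rightarrow> 'v \<Rightarrow> nat \<Rightarrow> 'v \<Rightarrow> bool" where
  "lagged_edge E v k w \<longleftrightarrow> (\<exists>t. ((v, t - int k), (w, t)) \<in> E)"

definition time_series_graph :: "'v ts_edges \<Rightarrow> bool" where
  "time_series_graph E \<longleftrightarrow>
     (\<forall>v w t k. ((v, t - k), (w, t)) \<in> E \<longrightarrow> k \<ge> 0 \<and> (\<forall>s. ((v, s - k), (w, s)) \<in> E)) \<and>
     finite {k. \<exists>v w. lagged_edge E v k w}"

definition process_graph :: "'v ts_edges \<Rightarrow> ('v \<times> 'v) set" where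
  "process_graph E = {(v, w). v \<noteq> w \<and> (\<exists>k. lagged_edge E v k w)}"

definition ts_graphs_of :: "('v \<times> 'v) set \<Rightarrow> 'v ts_edges set" where
  "ts_graphs_of D = {E. time_series_graph E \<and> process_graph E = D}"


section \<open>Parameters\<close>

text \<open>A parameter is a pair \<open>(\<Phi>, \<omega>)\<close>, with \<open>\<omega>\<close> the diagonal of \<open>\<Omega>\<close> and
  \<open>\<Phi> v w k\<close> the coefficient of the edge from \<open>v\<close> to \<open>w\<close> at lag \<open>k\<close>. The finite-dimensional
  coefficient space is the subspace of those \<open>\<Phi>\<close> that vanish off the lagged edges of the time
  series graph.  That subspace is closed in the product topology of the function type and carries
  its Euclidean topology, so \<open>closure\<close> below is the closure in the finite-dimensional space.\<close>

type_synonym 'v params = "('v \<Rightarrow> 'v \<Rightarrow> nat \<Rightarrow> real) \<times> ('v \<Rightarrow> real)"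

definition coefficient_space :: "'v ts_edges \<Rightarrow> ('v \<Rightarrow> 'v \<Rightarrow> nat \<Rightarrow> real) set" where
  "coefficient_space E = {\<Phi>. \<forall>v w k. \<not> lagged_edge E v k w \<longrightarrow> \<Phi> v w k = 0}"

definition stable_params :: "'v::finite set \<Rightarrow> 'v ts_edges \<Rightarrow> 'v params set" where
  "stable_params Ob E = {(\<Phi>, \<omega>). \<Phi> \<in> coefficient_space E \<and>
     (\<forall>v. (\<Sum>k | lagged_edge E v k v. \<bar>\<Phi> v v k\<bar>) < 1) \<and>
     (\<Sum>v\<in>Ob. \<Sum>w\<in>Ob. \<Sum>k | lagged_edge E v k w. \<bar>\<Phi> v w k\<bar>) < 1 \<and>
     (\<forall>v. \<omega> v > 0)}"

inductive param_polynomial :: "'v ts_edges \<Rightarrow> ('v params \<Rightarrow> real) \<Rightarrow> bool"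
  for E :: "'v ts_edges" where
  coefficient: "lagged_edge E v k w \<Longrightarrow> param_polynomial E (\<lambda>(\<Phi>, \<omega>). \<Phi> v w k)"
| variance: "param_polynomial E (\<lambda>(\<Phi>, \<omega>). \<omega> v)"
| const: "param_polynomial E (\<lambda>\<theta>. c)"
| add: "param_polynomial E p \<Longrightarrow> param_polynomial E q \<Longrightarrow> param_polynomial E (\<lambda>\<theta>. p \<theta> + q \<theta>)"
| mult: "param_polynomial E p \<Longrightarrow> param_polynomial E q \<Longrightarrow> param_polynomial E (\<lambda>\<theta>. p \<theta> * q \<theta>)"

definition proper_algebraic_subset ::
    "'v::finite set \<Rightarrow> 'v ts_edges \<Rightarrow> 'v params set \<Rightarrow> bool" where
  "proper_algebraic_subset Ob E A \<longleftrightarrow>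
     (\<exists>P. finite P \<and> (\<forall>p\<in>P. param_polynomial E p) \<and>
          A = {\<theta> \<in> closure (stable_params Ob E). \<forall>p\<in>P. p \<theta> = 0}) \<and>
     A \<noteq> closure (stable_params Ob E)"


section \<open>Link functions and the spectrum\<close>

type_synonym ratfun = "real poly fract"

definition poly_at_inverse :: "real poly \<Rightarrow> ratfun" where
  "poly_at_inverse p = poly (map_poly (\<lambda>c. to_fract [:c:]) p) (inverse (to_fract [:0, 1:]))"

definition star :: "ratfun \<Rightarrow> ratfun" where
  "star r = (THE s. \<exists>a b. b \<noteq> 0 \<and> r = Fract a b \<and> s = poly_at_inverse a / poly_at_inverse b)"

lemma poly_at_inverse_mult: "poly_at_inverse (p * q) = poly_at_inverse p * poly_at_inverse q"
proof -
  have const_mult: "[:a * b:] = [:a:] * [:b:]" for a b :: real by simp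
  have const_add: "[:a + b:] = [:a:] + [:b:]" for a b :: real by simp
  have const_sum: "[:sum f A:] = (\<Sum>i\<in>A. [:f i:])" for f :: "nat \<Rightarrow> real" and A
    by (induction A rule: infinite_finite_induct) (simp_all add: const_add del: add_pCons)
  have "map_poly (\<lambda>c. to_fract [:c:]) (p * q)
      = map_poly (\<lambda>c. to_fract [:c:]) p * map_poly (\<lambda>c. to_fract [:c:]) q"
    by (intro poly_eqI)
      (simp add: coeff_map_poly coeff_mult const_sum const_mult del: mult_pCons_left mult_pCons_right)
  then show ?thesis by (simp add: poly_at_inverse_def)
qed

lemma poly_at_inverse_eq_0_iff: "poly_at_inverse p = 0 \<longleftrightarrow> p = 0"
proof
  let ?c = "\<lambda>p :: real poly. map_poly (\<lambda>c. to_fract [:c:]) p"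
  let ?z = "to_fract [:0, 1 :: real:]"
  have deg: "degree (?c q) = degree q" for q by (intro degree_map_poly) simp
  have refl: "reflect_poly (?c q) = ?c (reflect_poly q)" for q
    by (intro poly_eqI) (simp add: coeff_reflect_poly coeff_map_poly deg)
  have at_z: "poly (?c q) ?z = to_fract q" for q
  proof (induction q)
    case (pCons a q)
    have "pCons a q = [:a:] + [:0, 1:] * q" by simp
    then have "to_fract (pCons a q) = to_fract [:a:] + ?z * to_fract q"
      by (simp only: to_fract_add to_fract_mult)
    then show ?case using pCons by (simp add: map_poly_pCons)
  qed simp
  assume "poly_at_inverse p = 0"
  then have "poly (reflect_poly (?c p)) ?z = 0"
    by (subst poly_reflect_poly_nz) (simp_all add: poly_at_inverse_def)
  then show "p = 0" by (simp add: refl at_z)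
qed (simp add: poly_at_inverse_def)

lemma star_Fract:
  assumes "b \<noteq> 0"
  shows "star (Fract a b) = poly_at_inverse a / poly_at_inverse b"
  unfolding star_def
proof (rule the_equality)
  fix s assume "\<exists>c d. d \<noteq> 0 \<and> Fract a b = Fract c d \<and> s = poly_at_inverse c / poly_at_inverse d"
  then obtain c d where d: "d \<noteq> 0" "Fract a b = Fract c d"
    and s: "s = poly_at_inverse c / poly_at_inverse d" by blast
  then have "a * d = c * b" using assms by (simp add: eq_fract)
  then have "poly_at_inverse a * poly_at_inverse d = poly_at_inverse c * poly_at_inverse b"
    by (metis poly_at_inverse_mult)
  then show "s = poly_at_inverse a / poly_at_inverse b"
    using assms d s by (simp add: frac_eq_eq poly_at_inverse_eq_0_iff)
qed (use assms in blast)

definition lag_poly :: "'v ts_edges \<Rightarrow> 'v params \<Rightarrow> 'v \<Rightarrow> 'v \<Rightarrow> ratfun" where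
  "lag_poly E \<theta> v w = to_fract (\<Sum>k | lagged_edge E v k w. monom (fst \<theta> v w k) k)"

definition link_matrix :: "'v::finite ts_edges \<Rightarrow> 'v params \<Rightarrow> ratfun^'v^'v" where
  "link_matrix E \<theta> = (\<chi> v w. if (v, w) \<in> process_graph E
                             then lag_poly E \<theta> v w / (1 - lag_poly E \<theta> w w) else 0)"

definition internal_spectrum :: "'v::finite ts_edges \<Rightarrow> 'v params \<Rightarrow> ratfun^'v^'v" where
  "internal_spectrum E \<theta> = (\<chi> v w. if v = w
     then to_fract [:snd \<theta> v:] * inverse (1 - lag_poly E \<theta> v v)
            * star (inverse (1 - lag_poly E \<theta> v v))
     else 0)"

text \<open>The submatrix with rows \<open>A\<close> and columns \<open>B\<close> is represented by a matrix over the full index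
  type, padded with zeros.  Products of padded matrices are the padded products.  For \<open>M\<close> padded
  outside \<open>Ob \<times> Ob\<close>, \<open>mat 1 - M\<close> is block diagonal with blocks \<open>I - M\<close> on \<open>Ob\<close> and the
  identity on the complement, so its inverse restricts to the inverse of the \<open>Ob\<close> block.  Hence
  \<open>observed_spectrum\<close> is the padded \<open>Ob \<times> Ob\<close> spectrum.\<close>

definition submat :: "'v set \<Rightarrow> 'v set \<Rightarrow> ratfun^'v^'v \<Rightarrow> ratfun^'v^'v" where
  "submat A B M = (\<chi> v w. if v \<in> A \<and> w \<in> B then M $ v $ w else 0)"

definition projected_internal_spectrum ::
    "'v::finite set \<Rightarrow> 'v set \<Rightarrow> 'v ts_edges \<Rightarrow> 'v params \<Rightarrow> ratfun^'v^'v" where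
  "projected_internal_spectrum Ob La E \<theta> =
     submat Ob Ob (internal_spectrum E \<theta>) +
     transpose (submat La Ob (link_matrix E \<theta>)) ** submat La La (internal_spectrum E \<theta>)
       ** map_matrix star (submat La Ob (link_matrix E \<theta>))"

definition observed_spectrum ::
    "'v::finite set \<Rightarrow> 'v set \<Rightarrow> 'v ts_edges \<Rightarrow> 'v params \<Rightarrow> ratfun^'v^'v" where
  "observed_spectrum Ob La E \<theta> =
     transpose (matrix_inv (mat 1 - submat Ob Ob (link_matrix E \<theta>)))
       ** projected_internal_spectrum Ob La E \<theta>
       ** matrix_inv (mat 1 - map_matrix star (submat Ob Ob (link_matrix E \<theta>)))"


section \<open>Rational identifiability\<close>

text \<open>Rational functions in the entries of a matrix.  Integer constants give subtraction (and,
  with division, all rational coefficients).\<close>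

datatype 'v ratexpr =
    Entry 'v 'v
  | Const int
  | Add "'v ratexpr" "'v ratexpr"
  | Mult "'v ratexpr" "'v ratexpr"
  | Div "'v ratexpr" "'v ratexpr"

primrec entries :: "'v ratexpr \<Rightarrow> ('v \<times> 'v) set" where
  "entries (Entry i j) = {(i, j)}"
| "entries (Const c) = {}"
| "entries (Add a b) = entries a \<union> entries b"
| "entries (Mult a b) = entries a \<union> entries b"
| "entries (Div a b) = entries a \<union> entries b"

primrec ratexpr_val :: "'v::finite ratexpr \<Rightarrow> ratfun^'v^'v \<Rightarrow> ratfun" where
  "ratexpr_val (Entry i j) M = M $ i $ j"
| "ratexpr_val (Const c) M = of_int c"
| "ratexpr_val (Add a b) M = ratexpr_val a M + ratexpr_val b M"
| "ratexpr_val (Mult a b) M = ratexpr_val a M * ratexpr_val b M"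
| "ratexpr_val (Div a b) M = ratexpr_val a M / ratexpr_val b M"

primrec ratexpr_defined :: "'v::finite ratexpr \<Rightarrow> ratfun^'v^'v \<Rightarrow> bool" where
  "ratexpr_defined (Entry i j) M \<longleftrightarrow> True"
| "ratexpr_defined (Const c) M \<longleftrightarrow> True"
| "ratexpr_defined (Add a b) M \<longleftrightarrow> ratexpr_defined a M \<and> ratexpr_defined b M"
| "ratexpr_defined (Mult a b) M \<longleftrightarrow> ratexpr_defined a M \<and> ratexpr_defined b M"
| "ratexpr_defined (Div a b) M \<longleftrightarrow>
     ratexpr_defined a M \<and> ratexpr_defined b M \<and> ratexpr_val b M \<noteq> 0"

definition rationally_identifiable ::
    "'v::finite set \<Rightarrow> 'v set \<Rightarrow> ('v \<times> 'v) set \<Rightarrow> 'v \<Rightarrow> 'v \<Rightarrow> bool" where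
  "rationally_identifiable Ob La D v w \<longleftrightarrow>
     (\<exists>\<psi>. entries \<psi> \<subseteq> Ob \<times> Ob \<and>
        (\<forall>E\<in>ts_graphs_of D. \<exists>A. proper_algebraic_subset Ob E A \<and>
           (\<forall>\<theta>\<in>stable_params Ob E - A.
              ratexpr_defined \<psi> (observed_spectrum Ob La E \<theta>) \<and>
              ratexpr_val \<psi> (observed_spectrum Ob La E \<theta>) = link_matrix E \<theta> $ v $ w)))"


section \<open>Half-treks and the latent factor half-trek criterion\<close>

definition directed_path :: "('v \<times> 'v) set \<Rightarrow> 'v list \<Rightarrow> bool" where
  "directed_path D p \<longleftrightarrow> p \<noteq> [] \<and> successively (\<lambda>u w. (u, w) \<in> D) p"

text \<open>A triple (Left, top, Right); both paths are listed starting from the top vertex, which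
  belongs to both of them.\<close>

type_synonym 'v trek = "'v list \<times> 'v \<times> 'v list"

definition is_trek :: "('v \<times> 'v) set \<Rightarrow> 'v trek \<Rightarrow> bool" where
  "is_trek D = (\<lambda>(Lf, top, Rt).
     directed_path D Lf \<and> hd Lf = top \<and> directed_path D Rt \<and> hd Rt = top)"

definition left_set :: "'v trek \<Rightarrow> 'v set" where
  "left_set = (\<lambda>(Lf, top, Rt). set Lf)"

definition right_set :: "'v trek \<Rightarrow> 'v set" where
  "right_set = (\<lambda>(Lf, top, Rt). set Rt)"

definition trek_source :: "'v trek \<Rightarrow> 'v" where
  "trek_source = (\<lambda>(Lf, top, Rt). last Lf)"

definition trek_target :: "'v trek \<Rightarrow> 'v" where
  "trek_target = (\<lambda>(Lf, top, Rt). last Rt)"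

definition lf_half_trek ::
    "'v set \<Rightarrow> 'v set \<Rightarrow> ('v \<times> 'v) set \<Rightarrow> 'v trek \<Rightarrow> bool" where
  "lf_half_trek Ob La D \<tau> \<longleftrightarrow> is_trek D \<tau> \<and>
     ((\<exists>v\<in>Ob. \<exists>w\<in>Ob. \<exists>l\<in>La. \<exists>xs. set xs \<subseteq> Ob \<and> \<tau> = ([l, v], l, l # xs @ [w])) \<or>
      (\<exists>v\<in>Ob. \<exists>w\<in>Ob. \<exists>xs. set xs \<subseteq> Ob \<and> \<tau> = ([v], v, v # xs @ [w])) \<or>
      (\<exists>v\<in>Ob. \<tau> = ([v], v, [v])))"

definition htr ::
    "'v set \<Rightarrow> 'v set \<Rightarrow> ('v \<times> 'v) set \<Rightarrow> 'v set \<Rightarrow> 'v set \<Rightarrow> 'v set" where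
  "htr Ob La D L' X = {w \<in> Ob. \<exists>x\<in>X. \<exists>\<tau>. lf_half_trek Ob La D \<tau> \<and>
     trek_source \<tau> = x \<and> trek_target \<tau> = w \<and> (left_set \<tau> \<union> right_set \<tau>) \<inter> L' = {}}"

definition trek_system :: "('v \<times> 'v) set \<Rightarrow> 'v set \<Rightarrow> 'v set \<Rightarrow> 'v trek set \<Rightarrow> bool" where
  "trek_system D A B T \<longleftrightarrow>
     (\<forall>\<tau>\<in>T. is_trek D \<tau>) \<and> bij_betw trek_source T A \<and> bij_betw trek_target T B"

definition no_sided_intersection :: "'v trek set \<Rightarrow> bool" where
  "no_sided_intersection T \<longleftrightarrow> (\<forall>\<sigma>\<in>T. \<forall>\<tau>\<in>T. \<sigma> \<noteq> \<tau> \<longrightarrow>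
     left_set \<sigma> \<inter> left_set \<tau> = {} \<and> right_set \<sigma> \<inter> right_set \<tau> = {})"

definition lf_htc ::
    "'v::finite set \<Rightarrow> 'v set \<Rightarrow> ('v \<times> 'v) set \<Rightarrow> 'v \<Rightarrow> 'v set \<Rightarrow> 'v set \<Rightarrow> 'v set \<Rightarrow> bool" where
  "lf_htc Ob La D v Y W L' \<longleftrightarrow>
     (card Y = card (parents_in D Ob {v}) + card L' \<and> card W = card L' \<and>
      W \<inter> parents_in D Ob {v} = {}) \<and>
     (Y \<inter> W = {} \<and> parents_in D La Y \<inter> parents_in D La (W \<union> {v}) \<subseteq> L') \<and>
     (\<exists>T. trek_system D Y (parents_in D Ob {v} \<union> W) T \<and>
        (\<forall>\<tau>\<in>T. lf_half_trek Ob La D \<tau>) \<and> no_sided_intersection T \<and>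
        (\<forall>\<tau>\<in>T. trek_target \<tau> \<in> W \<longrightarrow>
           (\<exists>y\<in>Y. \<exists>l\<in>L'. \<tau> = ([l, y], l, [l, trek_target \<tau>]))))"

end

theory Submission
  imports Defs
begin

text \<open>Write \<open>h\<close> for the link functions, \<open>S\<close> for the spectrum of the observed processes and \<open>s\<^sub>t\<close> for the
internal spectrum of a process \<open>t\<close>.  Let \<open>a\<close> be the matrix of direct effects (\<open>a\<^sub>t\<^sub>w\<close> is \<open>1\<close> if
\<open>t = w\<close> is observed, \<open>h\<^sub>t\<^sub>w\<close> if \<open>t\<close> is latent, and \<open>0\<close> otherwise) and let \<open>r = a (I - H)\<inverse>\<close>, with \<open>H\<close> the
links among observed processes, be the matrix of total effects, which sum the products of links over
all directed paths.  Then \<open>S = r\<^sup>T diag(s) r\<^sup>*\<close>.  Multiplication by \<open>I - H\<close> turns a column of \<open>r\<close> back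
into the column of \<open>a\<close>.  The links into \<open>W\<close> and into \<open>Y\<^sub>h = Y \<inter> htr\<^bsub>L'\<^esub>(W \<union> {v})\<close> are identifiable, so
this can be done on the left of \<open>S\<close> for the indices in \<open>W\<close> and on the right, with starred links, for
the indices in \<open>Y\<^sub>h\<close>.  (Since \<open>S\<^sup>* = S\<^sup>T\<close>, an expression for a link function yields its star when the two
indices of every entry of \<open>S\<close> are exchanged.)  The result is a matrix
\<open>M\<^sub>j\<^sub>y = \<Sum>\<^sub>t m\<^sub>t\<^sub>j s\<^sub>t n\<^sub>t\<^sub>y\<^sup>*\<close>, where column \<open>j\<close> of \<open>m\<close> comes from \<open>a\<close> for \<open>j \<in> W\<close> and from \<open>r\<close> otherwise, and
likewise for \<open>n\<close> with \<open>Y\<^sub>h\<close> in place of \<open>W\<close>.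

\<^bold>\<open>The linear system.\<close>  If \<open>j \<in> W \<union> {v}\<close>, \<open>y \<in> Y\<close> and \<open>a\<^sub>t\<^sub>j n\<^sub>t\<^sub>y \<noteq> 0\<close>, then \<open>t \<in> L'\<close>
(\<open>direct_mult_mixed_eq_0\<close>).  Otherwise \<open>t\<close> would be, for \<open>y \<in> Y\<^sub>h\<close>, a common latent parent of \<open>j\<close> and \<open>y\<close>
outside \<open>L'\<close>, which the criterion excludes, and for \<open>y \<notin> Y\<^sub>h\<close> the top of a half-trek from \<open>j\<close> to \<open>y\<close> that
avoids \<open>L'\<close>, which contradicts \<open>y \<notin> Y\<^sub>h\<close>.  Since \<open>W\<close> and \<open>L'\<close> are equally large, the
column of \<open>a\<close> at \<open>v\<close>, restricted to the rows in \<open>L'\<close>, is generically a combination of the columns at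
\<open>W\<close>.  Together with \<open>r\<^sub>t\<^sub>v = a\<^sub>t\<^sub>v + \<Sum>\<^sub>x r\<^sub>t\<^sub>x h\<^sub>x\<^sub>v\<close> this makes row \<open>v\<close> of \<open>M\<close> a combination of the rows in
\<open>pa(v) \<union> W\<close>, with coefficient \<open>h\<^sub>x\<^sub>v\<close> at \<open>x \<in> pa(v)\<close> (\<open>transformed_spectrum_solution\<close>).  There are as many
equations (one for each \<open>y \<in> Y\<close>) as unknowns, and Cramer's rule expresses \<open>h\<^sub>x\<^sub>v\<close> by \<open>S\<close> once the system
is nonsingular.

\<^bold>\<open>Generic nonsingularity\<close> (\<open>generic_solvable\<close>).  It suffices to find one parameter in the closure of the
stable parameters at which the determinant does not vanish, so some of the variances may be \<open>0\<close>.
Let the variance be \<open>1\<close> at the tops of the given half-treks and \<open>0\<close> elsewhere.  The tops are distinct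
and as many as the elements of \<open>Y\<close>, so \<open>M\<close> becomes a product of three square matrices indexed by the
half-treks: effects of the tops on \<open>Y\<close>, the internal spectra of the tops, and effects of the tops on
\<open>pa(v) \<union> W\<close>.  If only the edges on the Left paths carry nonzero coefficients, then the first factor is
diagonal because these paths are vertex-disjoint; if only the edges on the Right paths do, then the
last one is (\<open>disjoint_paths_effects\<close>).  Nonvanishing at two parameters with the same variances yields a
parameter on the segment between them at which both factors are nonsingular.\<close>

section \<open>The involution on rational functions and on rational expressions\<close>

(* In this file the dollar sign always denotes a vector component. *)
no_notation fps_nth (infixl \<open>$\<close> 75)

lemma to_fract_as_poly_value: "poly (map_poly (\<lambda>c. to_fract [:c:]) p) (to_fract [:0, 1 :: real:]) = to_fract p"
proof (induction p)
  case (pCons a p)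
  have "pCons a p = [:a:] + [:0, 1:] * p" by simp
  then have "to_fract (pCons a p) = to_fract [:a:] + to_fract [:0, 1:] * to_fract p"
    by (simp only: to_fract_add to_fract_mult)
  then show ?case using pCons by (simp add: map_poly_pCons)
qed simp

lemma poly_at_inverse_add: "poly_at_inverse (p + q) = poly_at_inverse p + poly_at_inverse q"
proof -
  have "[:a + b:] = [:a:] + [:b:]" for a b :: real by simp
  then have "map_poly (\<lambda>c. to_fract [:c:]) (p + q)
      = map_poly (\<lambda>c. to_fract [:c:]) p + map_poly (\<lambda>c. to_fract [:c:]) q"
    by (intro poly_eqI) (simp add: coeff_map_poly del: add_pCons)
  then show ?thesis by (simp add: poly_at_inverse_def)
qed

lemma poly_at_inverse_const: "poly_at_inverse [:c:] = to_fract [:c:]"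
  by (simp add: poly_at_inverse_def map_poly_pCons)

lemma star_to_fract: "star (to_fract p) = poly_at_inverse p"
  using star_Fract[of 1 p] poly_at_inverse_const[of 1]
  by (simp add: to_fract_def pCons_one flip: One_fract_def)

lemma star_const [simp]: "star (to_fract [:c:]) = to_fract [:c:]"
  by (simp add: star_to_fract poly_at_inverse_const)

lemma star_0 [simp]: "star 0 = 0"
  using star_const[of 0] by simp

lemma star_1 [simp]: "star 1 = 1"
  using star_const[of 1] by (simp add: pCons_one)

lemma star_add [simp]: "star (r + s) = star r + star s"
proof (cases r)
  case (Fract a b)
  show ?thesis
  proof (cases s)
    case (Fract c d)
    then show ?thesis using \<open>r = Fract a b\<close> \<open>b \<noteq> 0\<close>
      by (simp add: star_Fract poly_at_inverse_add poly_at_inverse_mult poly_at_inverse_eq_0_iff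
          add_frac_eq)
  qed
qed

lemma star_mult [simp]: "star (r * s) = star r * star s"
proof (cases r)
  case (Fract a b)
  show ?thesis
  proof (cases s)
    case (Fract c d)
    then show ?thesis using \<open>r = Fract a b\<close> \<open>b \<noteq> 0\<close>
      by (simp add: star_Fract poly_at_inverse_mult)
  qed
qed

lemma star_sum [simp]: "star (sum f A) = (\<Sum>i\<in>A. star (f i))"
  by (induction A rule: infinite_finite_induct) simp_all

lemma star_uminus [simp]: "star (- r) = - star r"
  using star_add[of r "- r"] by (simp add: eq_neg_iff_add_eq_0 add.commute del: star_add)

lemma star_diff [simp]: "star (r - s) = star r - star s"
  using star_add[of r "- s"] by (simp del: star_add)

lemma star_inverse [simp]: "star (inverse r) = inverse (star r)"
proof (cases "r = 0")
  case False
  then have "star r * star (inverse r) = 1"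
    by (simp flip: star_mult)
  then show ?thesis by (simp add: inverse_unique)
qed simp

lemma star_divide [simp]: "star (r / s) = star r / star s"
  by (simp add: divide_inverse)

lemma star_of_int [simp]: "star (of_int n) = of_int n"
proof -
  have nat: "star (of_nat m) = of_nat m" for m by (induction m) simp_all
  then show ?thesis by (cases n) (simp_all del: of_nat_Suc)
qed

lemma star_poly: "star (poly p x) = poly (map_poly star p) (star x)"
  by (induction p) (simp_all add: map_poly_pCons)

text \<open>The inverse of \<open>z\<close> is again the value of a polynomial after \<open>star\<close>: applying \<open>star\<close> to \<open>p(1/z)\<close> evaluates
the same constant coefficients at \<open>star (1/z) = z\<close>.\<close>

lemma star_star [simp]: "star (star r) = r"
proof -
  have *: "star (star (to_fract p)) = to_fract p" for p
  proof -
    have "map_poly star (map_poly (\<lambda>c. to_fract [:c:]) p) = map_poly (\<lambda>c. to_fract [:c:]) p"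
      by (intro poly_eqI) (simp add: coeff_map_poly)
    moreover have "star (inverse (to_fract [:0, 1:])) = to_fract [:0, 1:]"
      by (simp add: star_to_fract poly_at_inverse_def map_poly_pCons pCons_one)
    ultimately show ?thesis
      unfolding star_to_fract poly_at_inverse_def by (simp add: star_poly to_fract_as_poly_value)
  qed
  show ?thesis
    by (cases r) (simp add: * Fract_conv_to_fract)
qed

lemma star_eq_0_iff [simp]: "star r = 0 \<longleftrightarrow> r = 0"
  by (metis star_star star_0)

lemma map_matrix_star_mult:
  "map_matrix star (A ** B) = map_matrix star A ** map_matrix star (B :: ratfun^'n^'m)"
  by (simp add: vec_eq_iff matrix_matrix_mult_def)

lemma map_matrix_star_1 [simp]: "map_matrix star (mat 1) = (mat 1 :: ratfun^'n^'n)"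
  by (simp add: vec_eq_iff mat_def)

text \<open>Rational expressions have integer constants, and \<open>star\<close> is a field automorphism; hence the two commute.\<close>

lemma ratexpr_star:
  "ratexpr_defined \<psi> (map_matrix star M) \<longleftrightarrow> ratexpr_defined \<psi> M"
  "ratexpr_val \<psi> (map_matrix star M) = star (ratexpr_val \<psi> M)"
  by (induction \<psi>) auto

text \<open>The spectrum satisfies \<open>S\<^sup>* = S\<^sup>T\<close>, so evaluating the swapped expression at \<open>S\<close> produces the star of
the original value.  This is how starred link functions become available, as rational expressions
contain no \<open>star\<close>.\<close>

primrec swap_entries :: "'v ratexpr \<Rightarrow> 'v ratexpr" where
  "swap_entries (Entry i j) = Entry j i"
| "swap_entries (Const c) = Const c"
| "swap_entries (Add a b) = Add (swap_entries a) (swap_entries b)"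
| "swap_entries (Mult a b) = Mult (swap_entries a) (swap_entries b)"
| "swap_entries (Div a b) = Div (swap_entries a) (swap_entries b)"

lemma entries_swap_entries: "entries (swap_entries \<psi>) = (entries \<psi>)\<inverse>"
  by (induction \<psi>) auto

lemma ratexpr_swap_entries:
  "ratexpr_defined (swap_entries \<psi>) M \<longleftrightarrow> ratexpr_defined \<psi> (transpose M)"
  "ratexpr_val (swap_entries \<psi>) M = ratexpr_val \<psi> (transpose M)"
  by (induction \<psi>) (auto simp: transpose_def)

text \<open>One expression must serve all matrices in \<open>\<M>\<close>; it is only tested there, so that denominators
may vanish elsewhere.\<close>

definition computable_on ::
    "'v::finite set \<Rightarrow> (ratfun^'v^'v) set \<Rightarrow> (ratfun^'v^'v \<Rightarrow> ratfun) \<Rightarrow> bool" where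
  "computable_on Ob \<M> F \<longleftrightarrow> (\<exists>\<psi>. entries \<psi> \<subseteq> Ob \<times> Ob \<and>
     (\<forall>M\<in>\<M>. ratexpr_defined \<psi> M \<and> ratexpr_val \<psi> M = F M))"

named_theorems computable

lemma computable_onI:
  "entries \<psi> \<subseteq> Ob \<times> Ob \<Longrightarrow> (\<And>M. M \<in> \<M> \<Longrightarrow> ratexpr_defined \<psi> M \<and> ratexpr_val \<psi> M = F M) \<Longrightarrow>
   computable_on Ob \<M> F"
  unfolding computable_on_def by blast

lemma computable_on_entry [computable]:
  "i \<in> Ob \<Longrightarrow> j \<in> Ob \<Longrightarrow> computable_on Ob \<M> (\<lambda>M. M $ i $ j)"
  by (rule computable_onI[of "Entry i j"]) auto

lemma computable_on_of_int [computable]: "computable_on Ob \<M> (\<lambda>M. of_int c)"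
  by (rule computable_onI[of "Const c"]) auto

lemma computable_on_0 [computable]: "computable_on Ob \<M> (\<lambda>M. 0)"
  using computable_on_of_int[of _ _ 0] by simp

lemma computable_on_1 [computable]: "computable_on Ob \<M> (\<lambda>M. 1)"
  using computable_on_of_int[of _ _ 1] by simp

lemma computable_on_add [computable]:
  assumes "computable_on Ob \<M> F" "computable_on Ob \<M> G"
  shows "computable_on Ob \<M> (\<lambda>M. F M + G M)"
proof -
  from assms obtain \<psi> \<xi> where
    "entries \<psi> \<subseteq> Ob \<times> Ob \<and> (\<forall>M\<in>\<M>. ratexpr_defined \<psi> M \<and> ratexpr_val \<psi> M = F M)"
    "entries \<xi> \<subseteq> Ob \<times> Ob \<and> (\<forall>M\<in>\<M>. ratexpr_defined \<xi> M \<and> ratexpr_val \<xi> M = G M)"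
    unfolding computable_on_def by auto
  then show ?thesis by (intro computable_onI[of "Add \<psi> \<xi>"]) auto
qed

lemma computable_on_mult [computable]:
  assumes "computable_on Ob \<M> F" "computable_on Ob \<M> G"
  shows "computable_on Ob \<M> (\<lambda>M. F M * G M)"
proof -
  from assms obtain \<psi> \<xi> where
    "entries \<psi> \<subseteq> Ob \<times> Ob \<and> (\<forall>M\<in>\<M>. ratexpr_defined \<psi> M \<and> ratexpr_val \<psi> M = F M)"
    "entries \<xi> \<subseteq> Ob \<times> Ob \<and> (\<forall>M\<in>\<M>. ratexpr_defined \<xi> M \<and> ratexpr_val \<xi> M = G M)"
    unfolding computable_on_def by auto
  then show ?thesis by (intro computable_onI[of "Mult \<psi> \<xi>"]) auto
qed

lemma computable_on_divide [computable]:
  assumes "computable_on Ob \<M> F" "computable_on Ob \<M> G" "\<And>M. M \<in> \<M> \<Longrightarrow> G M \<noteq> 0"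
  shows "computable_on Ob \<M> (\<lambda>M. F M / G M)"
proof -
  from assms obtain \<psi> \<xi> where
    "entries \<psi> \<subseteq> Ob \<times> Ob \<and> (\<forall>M\<in>\<M>. ratexpr_defined \<psi> M \<and> ratexpr_val \<psi> M = F M)"
    "entries \<xi> \<subseteq> Ob \<times> Ob \<and> (\<forall>M\<in>\<M>. ratexpr_defined \<xi> M \<and> ratexpr_val \<xi> M = G M)"
    unfolding computable_on_def by auto
  then show ?thesis using assms(3) by (intro computable_onI[of "Div \<psi> \<xi>"]) auto
qed

lemma computable_on_diff [computable]:
  assumes "computable_on Ob \<M> F" "computable_on Ob \<M> G"
  shows "computable_on Ob \<M> (\<lambda>M. F M - G M)"
  using computable_on_add[OF assms(1) computable_on_mult[OF computable_on_of_int[of _ _ "-1"] assms(2)]]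
  by simp

lemma computable_on_sum [computable]:
  assumes "\<And>i. i \<in> A \<Longrightarrow> computable_on Ob \<M> (F i)"
  shows "computable_on Ob \<M> (\<lambda>M. \<Sum>i\<in>A. F i M)"
  using assms by (induction A rule: infinite_finite_induct) (auto intro: computable)

lemma computable_on_prod [computable]:
  assumes "\<And>i. i \<in> A \<Longrightarrow> computable_on Ob \<M> (F i)"
  shows "computable_on Ob \<M> (\<lambda>M. \<Prod>i\<in>A. F i M)"
  using assms by (induction A rule: infinite_finite_induct) (auto intro: computable)

lemma computable_on_det [computable]:
  assumes "\<And>i j. computable_on Ob \<M> (\<lambda>M. A M $ i $ j)"
  shows "computable_on Ob \<M> (\<lambda>M. det (A M))"
  unfolding det_def using assms by (intro computable)

section \<open>Generic parameters\<close>

text \<open>Variances may vanish here.  These parameters lie in the closure of the stable ones, so a polynomial that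
is nonzero at one of them cuts out a proper algebraic subset; the vanishing variances are what makes
the determinant of the half-trek system factor.\<close>

definition semistable_params :: "'v::finite set \<Rightarrow> 'v ts_edges \<Rightarrow> 'v params set" where
  "semistable_params Ob E = {(\<Phi>, \<omega>). \<Phi> \<in> coefficient_space E \<and>
     (\<forall>v. (\<Sum>k | lagged_edge E v k v. \<bar>\<Phi> v v k\<bar>) < 1) \<and>
     (\<Sum>v\<in>Ob. \<Sum>w\<in>Ob. \<Sum>k | lagged_edge E v k w. \<bar>\<Phi> v w k\<bar>) < 1 \<and>
     (\<forall>v. \<omega> v \<ge> 0)}"

lemma stable_subset_semistable: "stable_params Ob E \<subseteq> semistable_params Ob E"
  by (auto simp: stable_params_def semistable_params_def less_imp_le)

lemma semistable_subset_closure: "semistable_params Ob E \<subseteq> closure (stable_params Ob E)"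
proof
  fix \<theta> assume \<theta>: "\<theta> \<in> semistable_params Ob E"
  \<comment> \<open>raising all variances by \<open>s > 0\<close> makes the parameter stable\<close>
  define g where "g s = (fst \<theta>, \<lambda>v. snd \<theta> v + s)" for s :: real
  have "continuous_on UNIV g"
    unfolding g_def by (intro continuous_intros)
  then have cont: "continuous_on (closure {0<..}) g"
    using continuous_on_subset by blast
  have "g ` {0<..} \<subseteq> stable_params Ob E"
    using \<theta> by (auto simp: g_def stable_params_def semistable_params_def add_nonneg_pos)
  then have "g ` closure {0<..} \<subseteq> closure (stable_params Ob E)"
    by (intro image_closure_subset[OF cont] closed_closure) (use closure_subset in blast)
  moreover have "g 0 = \<theta>" by (simp add: g_def)
  moreover have "0 \<in> closure {0::real<..}" by simp
  ultimately show "\<theta> \<in> closure (stable_params Ob E)" by (metis image_subset_iff)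
qed

lemma param_polynomial_continuous:
  assumes "param_polynomial E p" shows "continuous_on UNIV p"
  using assms
proof induction
  case (coefficient v k w)
  have "continuous_on UNIV (\<lambda>\<theta> :: 'a params. fst \<theta> v w k)"
    using continuous_on_fst[OF continuous_on_id] by (blast dest: continuous_on_product_then_coordinatewise)
  then show ?case by (simp add: case_prod_unfold)
next
  case (variance v)
  have "continuous_on UNIV (\<lambda>\<theta> :: 'a params. snd \<theta> v)"
    using continuous_on_snd[OF continuous_on_id] by (blast dest: continuous_on_product_then_coordinatewise)
  then show ?case by (simp add: case_prod_unfold)
qed (auto intro: continuous_intros)

lemma param_polynomial_nonzero_on_closure:
  assumes "param_polynomial E p" "\<theta> \<in> closure S" "p \<theta> \<noteq> 0"
  shows "\<exists>\<theta>\<in>S. p \<theta> \<noteq> 0"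
proof (rule ccontr)
  assume "\<not> ?thesis"
  then have "p ` S \<subseteq> {0}" by auto
  then have "p ` closure S \<subseteq> {0}"
    using param_polynomial_continuous[OF assms(1)]
    by (intro image_closure_subset) (auto intro: continuous_on_subset)
  then show False using assms by auto
qed

definition param_segment :: "'v params \<Rightarrow> 'v params \<Rightarrow> real \<Rightarrow> 'v params" where
  "param_segment \<theta> \<theta>' s = (\<lambda>v w k. (1 - s) * fst \<theta> v w k + s * fst \<theta>' v w k,
                            \<lambda>v. (1 - s) * snd \<theta> v + s * snd \<theta>' v)"

lemma param_segment_ends [simp]: "param_segment \<theta> \<theta>' 0 = \<theta>" "param_segment \<theta> \<theta>' 1 = \<theta>'"
  by (simp_all add: param_segment_def)

lemma convex_combination_less_1:
  fixes a b s :: real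
  assumes "a < 1" "b < 1" "0 \<le> s" "s \<le> 1"
  shows "(1 - s) * a + s * b < 1"
proof -
  have "(1 - s) * a + s * b \<le> (1 - s) * max a b + s * max a b"
    using assms by (intro add_mono mult_left_mono) auto
  also have "\<dots> = max a b" by (simp add: algebra_simps)
  also have "\<dots> < 1" using assms by simp
  finally show ?thesis .
qed

lemma sum_abs_combination_le:
  fixes f g :: "'b \<Rightarrow> real"
  assumes "0 \<le> s" "s \<le> 1"
  shows "(\<Sum>i\<in>A. \<bar>(1 - s) * f i + s * g i\<bar>) \<le> (1 - s) * (\<Sum>i\<in>A. \<bar>f i\<bar>) + s * (\<Sum>i\<in>A. \<bar>g i\<bar>)"
  unfolding sum_distrib_left sum.distrib[symmetric]
proof (rule sum_mono)
  fix i
  show "\<bar>(1 - s) * f i + s * g i\<bar> \<le> (1 - s) * \<bar>f i\<bar> + s * \<bar>g i\<bar>"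
    using abs_triangle_ineq[of "(1 - s) * f i" "s * g i"] assms by (simp add: abs_mult)
qed

lemma param_segment_semistable:
  assumes "\<theta> \<in> semistable_params Ob E" "\<theta>' \<in> semistable_params Ob E" "0 \<le> s" "s \<le> 1"
  shows "param_segment \<theta> \<theta>' s \<in> semistable_params Ob E"
proof -
  have \<theta>: "fst \<theta> \<in> coefficient_space E" "\<And>v. (\<Sum>k | lagged_edge E v k v. \<bar>fst \<theta> v v k\<bar>) < 1"
      "(\<Sum>v\<in>Ob. \<Sum>w\<in>Ob. \<Sum>k | lagged_edge E v k w. \<bar>fst \<theta> v w k\<bar>) < 1" "\<And>v. snd \<theta> v \<ge> 0"
    and \<theta>': "fst \<theta>' \<in> coefficient_space E" "\<And>v. (\<Sum>k | lagged_edge E v k v. \<bar>fst \<theta>' v v k\<bar>) < 1"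
      "(\<Sum>v\<in>Ob. \<Sum>w\<in>Ob. \<Sum>k | lagged_edge E v k w. \<bar>fst \<theta>' v w k\<bar>) < 1" "\<And>v. snd \<theta>' v \<ge> 0"
    using assms(1,2) by (auto simp: semistable_params_def)
  let ?f = "\<lambda>v w k. (1 - s) * fst \<theta> v w k + s * fst \<theta>' v w k"
  have single: "(\<Sum>k | lagged_edge E v k v. \<bar>?f v v k\<bar>) < 1" for v
    by (rule le_less_trans[OF sum_abs_combination_le[OF assms(3,4)]
          convex_combination_less_1[OF \<theta>(2) \<theta>'(2) assms(3,4)]])
  have "(\<Sum>v\<in>Ob. \<Sum>w\<in>Ob. \<Sum>k | lagged_edge E v k w. \<bar>?f v w k\<bar>)
    \<le> (\<Sum>v\<in>Ob. \<Sum>w\<in>Ob. (1 - s) * (\<Sum>k | lagged_edge E v k w. \<bar>fst \<theta> v w k\<bar>)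
                         + s * (\<Sum>k | lagged_edge E v k w. \<bar>fst \<theta>' v w k\<bar>))"
    by (intro sum_mono sum_abs_combination_le[OF assms(3,4)])
  also have "\<dots> = (1 - s) * (\<Sum>v\<in>Ob. \<Sum>w\<in>Ob. \<Sum>k | lagged_edge E v k w. \<bar>fst \<theta> v w k\<bar>)
               + s * (\<Sum>v\<in>Ob. \<Sum>w\<in>Ob. \<Sum>k | lagged_edge E v k w. \<bar>fst \<theta>' v w k\<bar>)"
    by (simp add: sum.distrib sum_distrib_left)
  also have "\<dots> < 1"
    by (rule convex_combination_less_1[OF \<theta>(3) \<theta>'(3) assms(3,4)])
  finally show ?thesis
    using \<theta> \<theta>' single assms(3,4)
    by (auto simp: semistable_params_def param_segment_def coefficient_space_def)
qed

lemma param_polynomial_on_segment: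
  assumes "param_polynomial E p"
  shows "\<exists>q. \<forall>s. p (param_segment \<theta> \<theta>' s) = poly q s"
  using assms
proof induction
  case (coefficient v k w)
  show ?case
    by (rule exI[of _ "[:fst \<theta> v w k, fst \<theta>' v w k - fst \<theta> v w k:]"])
      (simp add: param_segment_def algebra_simps)
next
  case (variance v)
  show ?case
    by (rule exI[of _ "[:snd \<theta> v, snd \<theta>' v - snd \<theta> v:]"])
      (simp add: param_segment_def algebra_simps)
next
  case (const c)
  show ?case by (rule exI[of _ "[:c:]"]) simp
next
  case (add p q)
  then show ?case by (metis poly_add)
next
  case (mult p q)
  then show ?case by (metis poly_mult)
qed

text \<open>A substitute for the irreducibility of the parameter space: restricted to a segment, both polynomials become
nonzero univariate polynomials, which have only finitely many zeros.\<close>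

lemma param_polynomials_nonzero_on_segment:
  assumes "param_polynomial E p" "param_polynomial E q" "p \<theta> \<noteq> 0" "q \<theta>' \<noteq> 0"
  shows "\<exists>s. 0 \<le> s \<and> s \<le> 1 \<and> p (param_segment \<theta> \<theta>' s) \<noteq> 0 \<and> q (param_segment \<theta> \<theta>' s) \<noteq> 0"
proof -
  obtain p' where p': "p (param_segment \<theta> \<theta>' s) = poly p' s" for s
    using param_polynomial_on_segment[OF assms(1)] by blast
  obtain q' where q': "q (param_segment \<theta> \<theta>' s) = poly q' s" for s
    using param_polynomial_on_segment[OF assms(2)] by blast
  have "p' * q' \<noteq> 0"
    using assms(3,4) p'[of 0] q'[of 1] by auto
  then have "finite {s. poly (p' * q') s = 0}" by (rule poly_roots_finite)
  moreover have "infinite {0..1::real}" by (simp add: infinite_Icc)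
  ultimately have "\<not> {0..1} \<subseteq> {s. poly (p' * q') s = 0}"
    using finite_subset by blast
  then show ?thesis by (auto simp: p' q')
qed

text \<open>A single polynomial \<open>p\<close> replaces the finite system of equations of an algebraic subset: one equation that
does not vanish identically already cuts out a proper subset that contains the original one.\<close>

definition generic :: "'v::finite set \<Rightarrow> 'v ts_edges \<Rightarrow> ('v params \<Rightarrow> bool) \<Rightarrow> bool" where
  "generic Ob E P \<longleftrightarrow> (\<exists>p. param_polynomial E p \<and> (\<exists>\<theta>\<in>semistable_params Ob E. p \<theta> \<noteq> 0) \<and>
     (\<forall>\<theta>\<in>stable_params Ob E. p \<theta> \<noteq> 0 \<longrightarrow> P \<theta>))"

lemma generic_iff_proper_algebraic_subset:
  "generic Ob E P \<longleftrightarrow> (\<exists>A. proper_algebraic_subset Ob E A \<and> (\<forall>\<theta>\<in>stable_params Ob E - A. P \<theta>))"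
proof
  assume "generic Ob E P"
  then obtain p where p: "param_polynomial E p" "\<exists>\<theta>\<in>semistable_params Ob E. p \<theta> \<noteq> 0"
    "\<forall>\<theta>\<in>stable_params Ob E. p \<theta> \<noteq> 0 \<longrightarrow> P \<theta>"
    unfolding generic_def by blast
  let ?A = "{\<theta> \<in> closure (stable_params Ob E). \<forall>q\<in>{p}. q \<theta> = 0}"
  have "proper_algebraic_subset Ob E ?A"
    unfolding proper_algebraic_subset_def
  proof (intro conjI exI)
    show "finite {p}" "\<forall>q\<in>{p}. param_polynomial E q" using p(1) by auto
    show "?A \<noteq> closure (stable_params Ob E)"
      using p(2) semistable_subset_closure[of Ob E] by fastforce
  qed simp
  moreover have "\<forall>\<theta>\<in>stable_params Ob E - ?A. P \<theta>"
    using p(3) closure_subset by blast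
  ultimately show "\<exists>A. proper_algebraic_subset Ob E A \<and> (\<forall>\<theta>\<in>stable_params Ob E - A. P \<theta>)"
    by blast
next
  assume "\<exists>A. proper_algebraic_subset Ob E A \<and> (\<forall>\<theta>\<in>stable_params Ob E - A. P \<theta>)"
  then obtain A Q where Q: "\<forall>q\<in>Q. param_polynomial E q"
    and A: "A = {\<theta> \<in> closure (stable_params Ob E). \<forall>q\<in>Q. q \<theta> = 0}"
      "A \<noteq> closure (stable_params Ob E)" and P: "\<forall>\<theta>\<in>stable_params Ob E - A. P \<theta>"
    unfolding proper_algebraic_subset_def by blast
  from A obtain \<theta> q where "\<theta> \<in> closure (stable_params Ob E)" and q: "q \<in> Q" "q \<theta> \<noteq> 0" by blast
  then have "\<exists>\<theta>\<in>stable_params Ob E. q \<theta> \<noteq> 0"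
    using Q param_polynomial_nonzero_on_closure by blast
  then show "generic Ob E P"
    unfolding generic_def using stable_subset_semistable[of Ob E] Q q P A(1) by blast
qed

lemma generic_conj:
  assumes "generic Ob E P" "generic Ob E Q"
  shows "generic Ob E (\<lambda>\<theta>. P \<theta> \<and> Q \<theta>)"
proof -
  obtain p \<theta> where p: "param_polynomial E p" "\<theta> \<in> semistable_params Ob E" "p \<theta> \<noteq> 0"
    "\<forall>\<theta>\<in>stable_params Ob E. p \<theta> \<noteq> 0 \<longrightarrow> P \<theta>"
    using assms(1) unfolding generic_def by blast
  obtain q \<theta>' where q: "param_polynomial E q" "\<theta>' \<in> semistable_params Ob E" "q \<theta>' \<noteq> 0"
    "\<forall>\<theta>\<in>stable_params Ob E. q \<theta> \<noteq> 0 \<longrightarrow> Q \<theta>"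
    using assms(2) unfolding generic_def by blast
  obtain s where "0 \<le> s" "s \<le> 1" "p (param_segment \<theta> \<theta>' s) \<noteq> 0" "q (param_segment \<theta> \<theta>' s) \<noteq> 0"
    using param_polynomials_nonzero_on_segment[OF p(1) q(1) p(3) q(3)] by blast
  then show ?thesis
    unfolding generic_def
    by (intro exI[of _ "\<lambda>\<theta>. p \<theta> * q \<theta>"] conjI param_polynomial.mult p(1) q(1)
        bexI[of _ "param_segment \<theta> \<theta>' s"] param_segment_semistable p(2) q(2))
      (use p(4) q(4) in auto)
qed

lemma generic_True:
  assumes "\<theta> \<in> semistable_params Ob E"
  shows "generic Ob E (\<lambda>\<theta>. True)"
  unfolding generic_def using assms param_polynomial.const[of E 1]
  by (intro exI[of _ "\<lambda>\<theta>. 1"] conjI bexI[of _ \<theta>]) auto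

lemma generic_Ball:
  assumes "\<theta> \<in> semistable_params Ob E" "finite I" "\<And>i. i \<in> I \<Longrightarrow> generic Ob E (P i)"
  shows "generic Ob E (\<lambda>\<theta>. \<forall>i\<in>I. P i \<theta>)"
  using assms(2,3)
  by (induction I rule: finite_induct) (auto intro: generic_True[OF assms(1)] generic_conj)

lemma generic_mono:
  assumes "generic Ob E P" "\<And>\<theta>. \<theta> \<in> stable_params Ob E \<Longrightarrow> P \<theta> \<Longrightarrow> Q \<theta>"
  shows "generic Ob E Q"
  using assms unfolding generic_def by blast


section \<open>Rational functions of the parameters\<close>

text \<open>The class contains everything built in the computation of the spectrum, constants in \<open>\<real>(z)\<close> and
\<open>star\<close> included.  Inverses are taken only of functions that have no zero among the semistable parameters,
so denominators never interfere with genericity.\<close>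

inductive param_rational ::
    "'v::finite set \<Rightarrow> 'v ts_edges \<Rightarrow> ('v params \<Rightarrow> ratfun) \<Rightarrow> bool"
  for Ob :: "'v set" and E :: "'v ts_edges" where
  const: "param_rational Ob E (\<lambda>\<theta>. r)"
| polynomial: "param_polynomial E p \<Longrightarrow> param_rational Ob E (\<lambda>\<theta>. to_fract [:p \<theta>:])"
| add: "param_rational Ob E F \<Longrightarrow> param_rational Ob E G \<Longrightarrow> param_rational Ob E (\<lambda>\<theta>. F \<theta> + G \<theta>)"
| mult: "param_rational Ob E F \<Longrightarrow> param_rational Ob E G \<Longrightarrow> param_rational Ob E (\<lambda>\<theta>. F \<theta> * G \<theta>)"
| inverse: "param_rational Ob E F \<Longrightarrow> (\<And>\<theta>. \<theta> \<in> semistable_params Ob E \<Longrightarrow> F \<theta> \<noteq> 0) \<Longrightarrow>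
    param_rational Ob E (\<lambda>\<theta>. inverse (F \<theta>))"

lemma param_rational_diff:
  assumes "param_rational Ob E F" "param_rational Ob E G"
  shows "param_rational Ob E (\<lambda>\<theta>. F \<theta> - G \<theta>)"
  using param_rational.add[OF assms(1) param_rational.mult[OF param_rational.const[of _ _ "-1"] assms(2)]]
  by simp

lemma param_rational_sum:
  assumes "\<And>i. i \<in> A \<Longrightarrow> param_rational Ob E (F i)"
  shows "param_rational Ob E (\<lambda>\<theta>. \<Sum>i\<in>A. F i \<theta>)"
  using assms by (induction A rule: infinite_finite_induct) (auto intro: param_rational.intros)

lemma param_rational_prod:
  assumes "\<And>i. i \<in> A \<Longrightarrow> param_rational Ob E (F i)"
  shows "param_rational Ob E (\<lambda>\<theta>. \<Prod>i\<in>A. F i \<theta>)"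
  using assms by (induction A rule: infinite_finite_induct) (auto intro: param_rational.intros)

lemma param_rational_det:
  assumes "\<And>i j. param_rational Ob E (\<lambda>\<theta>. A \<theta> $ i $ j)"
  shows "param_rational Ob E (\<lambda>\<theta>. det (A \<theta>))"
  unfolding det_def
  by (intro param_rational_sum param_rational.mult param_rational.const param_rational_prod assms)

lemma param_rational_star:
  assumes "param_rational Ob E F"
  shows "param_rational Ob E (\<lambda>\<theta>. star (F \<theta>))"
  using assms by induction (simp_all add: param_rational.intros)

lemma param_polynomial_sum:
  assumes "\<And>i. i \<in> A \<Longrightarrow> param_polynomial E (p i)"
  shows "param_polynomial E (\<lambda>\<theta>. \<Sum>i\<in>A. p i \<theta>)"
  using assms
  by (induction A rule: infinite_finite_induct) (auto intro: param_polynomial.intros)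

lemma param_polynomial_coeff_mult:
  assumes "\<And>n. param_polynomial E (\<lambda>\<theta>. coeff (p \<theta>) n)" "\<And>n. param_polynomial E (\<lambda>\<theta>. coeff (q \<theta>) n)"
  shows "param_polynomial E (\<lambda>\<theta>. coeff (p \<theta> * q \<theta>) n)"
  unfolding coeff_mult by (intro param_polynomial_sum param_polynomial.mult assms)

text \<open>Clearing denominators: the value is a quotient of polynomials in \<open>z\<close> whose coefficients are polynomials in the
parameters.  Nonvanishing in \<open>\<real>(z)\<close> is then nonvanishing of some coefficient, which is a polynomial condition.\<close>

lemma param_rational_quotient:
  assumes "param_rational Ob E F"
  shows "\<exists>p q. (\<forall>n. param_polynomial E (\<lambda>\<theta>. coeff (p \<theta>) n)) \<and>
               (\<forall>n. param_polynomial E (\<lambda>\<theta>. coeff (q \<theta>) n)) \<and>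
               (\<forall>\<theta>\<in>semistable_params Ob E. q \<theta> \<noteq> 0 \<and> F \<theta> = to_fract (p \<theta>) / to_fract (q \<theta>))"
  using assms
proof induction
  case (const r)
  obtain a b where "r = Fract a b" "b \<noteq> 0" by (cases r)
  then show ?case
    by (intro exI[of _ "\<lambda>\<theta>. a"] exI[of _ "\<lambda>\<theta>. b"])
      (auto simp: Fract_conv_to_fract intro: param_polynomial.const)
next
  case (polynomial p)
  have "param_polynomial E (\<lambda>\<theta>. coeff [:p \<theta>:] n)" for n
    using polynomial by (cases n) (auto intro: param_polynomial.const)
  then show ?case
    by (intro exI[of _ "\<lambda>\<theta>. [:p \<theta>:]"] exI[of _ "\<lambda>\<theta>. 1"]) (auto intro: param_polynomial.const)
next
  case (add F G)
  then obtain p q p' q' where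
    *: "\<And>n. param_polynomial E (\<lambda>\<theta>. coeff (p \<theta>) n)" "\<And>n. param_polynomial E (\<lambda>\<theta>. coeff (q \<theta>) n)"
      "\<And>n. param_polynomial E (\<lambda>\<theta>. coeff (p' \<theta>) n)" "\<And>n. param_polynomial E (\<lambda>\<theta>. coeff (q' \<theta>) n)"
    and "\<forall>\<theta>\<in>semistable_params Ob E. q \<theta> \<noteq> 0 \<and> F \<theta> = to_fract (p \<theta>) / to_fract (q \<theta>)"
      "\<forall>\<theta>\<in>semistable_params Ob E. q' \<theta> \<noteq> 0 \<and> G \<theta> = to_fract (p' \<theta>) / to_fract (q' \<theta>)"
    by metis
  then have "\<forall>\<theta>\<in>semistable_params Ob E. q \<theta> * q' \<theta> \<noteq> 0 \<and>
      F \<theta> + G \<theta> = to_fract (p \<theta> * q' \<theta> + p' \<theta> * q \<theta>) / to_fract (q \<theta> * q' \<theta>)"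
    by (auto simp: add_frac_eq)
  moreover have "param_polynomial E (\<lambda>\<theta>. coeff (p \<theta> * q' \<theta> + p' \<theta> * q \<theta>) n)" for n
    unfolding coeff_add by (intro param_polynomial.add param_polynomial_coeff_mult *)
  moreover have "param_polynomial E (\<lambda>\<theta>. coeff (q \<theta> * q' \<theta>) n)" for n
    by (intro param_polynomial_coeff_mult *)
  ultimately show ?case
    by (intro exI[of _ "\<lambda>\<theta>. p \<theta> * q' \<theta> + p' \<theta> * q \<theta>"] exI[of _ "\<lambda>\<theta>. q \<theta> * q' \<theta>"]) blast
next
  case (mult F G)
  then obtain p q p' q' where
    *: "\<And>n. param_polynomial E (\<lambda>\<theta>. coeff (p \<theta>) n)" "\<And>n. param_polynomial E (\<lambda>\<theta>. coeff (q \<theta>) n)"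
      "\<And>n. param_polynomial E (\<lambda>\<theta>. coeff (p' \<theta>) n)" "\<And>n. param_polynomial E (\<lambda>\<theta>. coeff (q' \<theta>) n)"
    and "\<forall>\<theta>\<in>semistable_params Ob E. q \<theta> \<noteq> 0 \<and> F \<theta> = to_fract (p \<theta>) / to_fract (q \<theta>)"
      "\<forall>\<theta>\<in>semistable_params Ob E. q' \<theta> \<noteq> 0 \<and> G \<theta> = to_fract (p' \<theta>) / to_fract (q' \<theta>)"
    by metis
  then have "\<forall>\<theta>\<in>semistable_params Ob E. q \<theta> * q' \<theta> \<noteq> 0 \<and>
      F \<theta> * G \<theta> = to_fract (p \<theta> * p' \<theta>) / to_fract (q \<theta> * q' \<theta>)"
    by auto
  moreover have "param_polynomial E (\<lambda>\<theta>. coeff (p \<theta> * p' \<theta>) n)"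
    "param_polynomial E (\<lambda>\<theta>. coeff (q \<theta> * q' \<theta>) n)" for n
    by (intro param_polynomial_coeff_mult *)+
  ultimately show ?case
    by (intro exI[of _ "\<lambda>\<theta>. p \<theta> * p' \<theta>"] exI[of _ "\<lambda>\<theta>. q \<theta> * q' \<theta>"]) blast
next
  case (inverse F)
  then obtain p q where
    *: "\<forall>n. param_polynomial E (\<lambda>\<theta>. coeff (p \<theta>) n)" "\<forall>n. param_polynomial E (\<lambda>\<theta>. coeff (q \<theta>) n)"
      "\<forall>\<theta>\<in>semistable_params Ob E. q \<theta> \<noteq> 0 \<and> F \<theta> = to_fract (p \<theta>) / to_fract (q \<theta>)"
    by metis
  then have "\<forall>\<theta>\<in>semistable_params Ob E. p \<theta> \<noteq> 0 \<and> inverse (F \<theta>) = to_fract (q \<theta>) / to_fract (p \<theta>)"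
    using inverse(2) by force
  then show ?case using * by blast
qed

lemma param_rational_nonzero_polynomial:
  assumes "param_rational Ob E F" "\<theta> \<in> semistable_params Ob E" "F \<theta> \<noteq> 0"
  shows "\<exists>c. param_polynomial E c \<and> c \<theta> \<noteq> 0 \<and> (\<forall>\<theta>\<in>semistable_params Ob E. c \<theta> \<noteq> 0 \<longrightarrow> F \<theta> \<noteq> 0)"
proof -
  obtain p q where *: "\<forall>n. param_polynomial E (\<lambda>\<theta>. coeff (p \<theta>) n)"
      "\<forall>\<theta>\<in>semistable_params Ob E. q \<theta> \<noteq> 0 \<and> F \<theta> = to_fract (p \<theta>) / to_fract (q \<theta>)"
    using param_rational_quotient[OF assms(1)] by blast
  then have "p \<theta> \<noteq> 0" using assms(2,3) by force
  then obtain n where "coeff (p \<theta>) n \<noteq> 0" using leading_coeff_0_iff by blast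
  moreover have "F \<theta>' \<noteq> 0" if "\<theta>' \<in> semistable_params Ob E" "coeff (p \<theta>') n \<noteq> 0" for \<theta>'
    using * that by (metis coeff_0 divide_eq_0_iff to_fract_eq_0_iff)
  ultimately show ?thesis using *(1) by (intro exI[of _ "\<lambda>\<theta>. coeff (p \<theta>) n"]) blast
qed

lemma generic_nonzero:
  assumes "param_rational Ob E F" "\<theta> \<in> semistable_params Ob E" "F \<theta> \<noteq> 0"
  shows "generic Ob E (\<lambda>\<theta>. F \<theta> \<noteq> 0)"
  using param_rational_nonzero_polynomial[OF assms] assms(2) stable_subset_semistable[of Ob E]
  unfolding generic_def by blast

lemma param_rationals_nonzero_on_segment:
  assumes "param_rational Ob E F" "\<theta> \<in> semistable_params Ob E" "F \<theta> \<noteq> 0"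
    and "param_rational Ob E G" "\<theta>' \<in> semistable_params Ob E" "G \<theta>' \<noteq> 0"
  shows "\<exists>s. param_segment \<theta> \<theta>' s \<in> semistable_params Ob E \<and>
             F (param_segment \<theta> \<theta>' s) \<noteq> 0 \<and> G (param_segment \<theta> \<theta>' s) \<noteq> 0"
proof -
  obtain c where c: "param_polynomial E c" "c \<theta> \<noteq> 0"
    "\<forall>\<theta>\<in>semistable_params Ob E. c \<theta> \<noteq> 0 \<longrightarrow> F \<theta> \<noteq> 0"
    using param_rational_nonzero_polynomial[OF assms(1-3)] by blast
  obtain d where d: "param_polynomial E d" "d \<theta>' \<noteq> 0"
    "\<forall>\<theta>\<in>semistable_params Ob E. d \<theta> \<noteq> 0 \<longrightarrow> G \<theta> \<noteq> 0"
    using param_rational_nonzero_polynomial[OF assms(4-6)] by blast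
  from param_polynomials_nonzero_on_segment[OF c(1) d(1) c(2) d(2)] c(3) d(3)
    param_segment_semistable[OF assms(2,5)] show ?thesis by blast
qed


section \<open>Link functions as rational functions of the parameters\<close>

lemma finite_lags: "time_series_graph E \<Longrightarrow> finite {k. lagged_edge E v k w}"
  unfolding time_series_graph_def by (rule finite_subset[rotated]) auto

lemma param_rational_lag_poly: "param_rational Ob E (\<lambda>\<theta>. lag_poly E \<theta> v w)"
proof -
  have monom: "[:c:] * monom 1 k = monom c k" for c :: real and k
    by (simp add: smult_monom)
  have to_fract_monom: "to_fract (monom c k) = to_fract [:c:] * to_fract (monom 1 k)"
    for c :: real and k
    unfolding to_fract_mult[symmetric] monom ..
  have lag_poly: "lag_poly E \<theta> v w
      = (\<Sum>k | lagged_edge E v k w. to_fract [:fst \<theta> v w k:] * to_fract (monom 1 k))" for \<theta>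
    unfolding lag_poly_def to_fract_sum by (intro sum.cong to_fract_monom refl)
  have "param_polynomial E (\<lambda>\<theta>. fst \<theta> v w k)" if "lagged_edge E v k w" for k
    using param_polynomial.coefficient[OF that] by (simp add: case_prod_unfold)
  then show ?thesis
    unfolding lag_poly
    by (intro param_rational_sum param_rational.mult param_rational.polynomial
        param_rational.const) simp
qed

text \<open>The constant coefficient of the auto-lag polynomial is less than \<open>1\<close> by stability.\<close>

lemma auto_lag_nonzero:
  assumes "time_series_graph E" "\<theta> \<in> semistable_params Ob E"
  shows "1 - lag_poly E \<theta> v v \<noteq> 0"
proof -
  let ?p = "\<Sum>k | lagged_edge E v k v. monom (fst \<theta> v v k) k"
  have "coeff ?p 0 \<le> (\<Sum>k | lagged_edge E v k v. \<bar>fst \<theta> v v k\<bar>)"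
    unfolding coeff_sum by (rule sum_mono) auto
  also have "\<dots> < 1" using assms(2) by (auto simp: semistable_params_def)
  finally have "coeff ?p 0 \<noteq> 1" by simp
  then have "?p \<noteq> 1" by auto
  then have "to_fract ?p \<noteq> to_fract 1" using to_fract_eq_iff by blast
  then show ?thesis by (simp add: lag_poly_def)
qed

lemma param_rational_link_matrix:
  assumes "time_series_graph E"
  shows "param_rational Ob E (\<lambda>\<theta>. link_matrix E \<theta> $ v $ w)"
proof (cases "(v, w) \<in> process_graph E")
  case True
  have "param_rational Ob E (\<lambda>\<theta>. lag_poly E \<theta> v w * inverse (1 - lag_poly E \<theta> w w))"
    by (intro param_rational.mult param_rational.inverse param_rational_diff
        param_rational_lag_poly param_rational.const auto_lag_nonzero[OF assms])
  then show ?thesis using True by (simp add: link_matrix_def divide_inverse)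
qed (simp add: link_matrix_def param_rational.const)

lemma param_rational_internal_spectrum:
  assumes "time_series_graph E"
  shows "param_rational Ob E (\<lambda>\<theta>. internal_spectrum E \<theta> $ v $ w)"
proof -
  have "param_polynomial E (\<lambda>\<theta>. snd \<theta> v)"
    using param_polynomial.variance[of E v] by (simp add: case_prod_unfold)
  then have "param_rational Ob E (\<lambda>\<theta>. to_fract [:snd \<theta> v:] * inverse (1 - lag_poly E \<theta> v v)
      * star (inverse (1 - lag_poly E \<theta> v v)))"
    by (intro param_rational.mult param_rational.inverse param_rational_diff
        param_rational_star param_rational.polynomial
        param_rational_lag_poly param_rational.const auto_lag_nonzero[OF assms])
  then show ?thesis by (cases "v = w") (simp_all add: internal_spectrum_def param_rational.const)
qed

lemma internal_spectrum_eq_0_iff: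
  assumes "time_series_graph E" "\<theta> \<in> semistable_params Ob E"
  shows "internal_spectrum E \<theta> $ v $ v = 0 \<longleftrightarrow> snd \<theta> v = 0"
proof -
  have "star (1 - lag_poly E \<theta> v v) \<noteq> 0"
    using auto_lag_nonzero[OF assms] by (simp only: star_eq_0_iff) simp
  then show ?thesis using auto_lag_nonzero[OF assms, of v] by (simp add: internal_spectrum_def)
qed

text \<open>Any set of links can be switched on while all others, and all auto-lags, are zero: each chosen link gets a single
lag with the coefficient \<open>\<epsilon>\<close>, which is small enough for the stability condition.\<close>

lemma exists_params_with_links:
  fixes E :: "'v::finite ts_edges"
  assumes E: "time_series_graph E" and F: "F \<subseteq> process_graph E" and \<omega>: "\<And>v. \<omega> v \<ge> 0"
  shows "\<exists>\<theta>\<in>semistable_params Ob E. snd \<theta> = \<omega> \<and>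
           (\<forall>v w. link_matrix E \<theta> $ v $ w \<noteq> 0 \<longleftrightarrow> (v, w) \<in> F)"
proof -
  define \<kappa> where "\<kappa> v w = (SOME k. lagged_edge E v k w)" for v w
  have \<kappa>: "lagged_edge E v (\<kappa> v w) w" if "(v, w) \<in> F" for v w
    using that F unfolding \<kappa>_def process_graph_def by (auto intro: someI)
  have no_loop: "(v, v) \<notin> F" for v using F by (auto simp: process_graph_def)
  \<comment> \<open>at most \<open>card Ob * card Ob\<close> coefficients of size \<open>\<epsilon>\<close> enter the second stability condition\<close>
  define \<epsilon> :: real where "\<epsilon> = 1 / (real (card Ob) * real (card Ob) + 1)"
  have "real (card Ob) * real (card Ob) + 1 > 0" by (rule add_nonneg_pos) simp_all
  then have \<epsilon>: "\<epsilon> > 0" "real (card Ob) * real (card Ob) * \<epsilon> < 1"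
    unfolding \<epsilon>_def by (simp_all add: divide_less_eq)
  define \<Phi> where "\<Phi> v w k = (if (v, w) \<in> F \<and> k = \<kappa> v w then \<epsilon> else 0)" for v w k
  have sum_abs: "(\<Sum>k | lagged_edge E v k w. \<bar>\<Phi> v w k\<bar>) = (if (v, w) \<in> F then \<epsilon> else 0)" for v w
  proof (cases "(v, w) \<in> F")
    case True
    then have "(\<Sum>k | lagged_edge E v k w. \<bar>\<Phi> v w k\<bar>)
        = (\<Sum>k | lagged_edge E v k w. if k = \<kappa> v w then \<epsilon> else 0)"
      using \<epsilon>(1) by (intro sum.cong) (auto simp: \<Phi>_def)
    then show ?thesis using \<kappa>[OF True] finite_lags[OF E] True by simp
  qed (simp add: \<Phi>_def)
  have "(\<Sum>v\<in>Ob. \<Sum>w\<in>Ob. \<Sum>k | lagged_edge E v k w. \<bar>\<Phi> v w k\<bar>) \<le> (\<Sum>v\<in>Ob. \<Sum>w\<in>Ob. \<epsilon>)"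
    using \<epsilon>(1) by (intro sum_mono) (simp add: sum_abs)
  also have "\<dots> < 1" using \<epsilon>(2) by (simp add: mult.assoc)
  finally have semistable: "(\<Phi>, \<omega>) \<in> semistable_params Ob E"
    using \<omega> \<kappa> by (auto simp: semistable_params_def coefficient_space_def sum_abs no_loop)
      (auto simp: \<Phi>_def split: if_splits)
  have lag_poly: "lag_poly E (\<Phi>, \<omega>) v w = (if (v, w) \<in> F then to_fract (monom \<epsilon> (\<kappa> v w)) else 0)"
    for v w
  proof (cases "(v, w) \<in> F")
    case True
    then have "(\<Sum>k | lagged_edge E v k w. monom (\<Phi> v w k) k)
        = (\<Sum>k | lagged_edge E v k w. if k = \<kappa> v w then monom \<epsilon> k else 0)"
      by (intro sum.cong) (auto simp: \<Phi>_def)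
    then show ?thesis using \<kappa>[OF True] finite_lags[OF E] True by (simp add: lag_poly_def)
  qed (simp add: \<Phi>_def lag_poly_def)
  have "link_matrix E (\<Phi>, \<omega>) $ v $ w \<noteq> 0 \<longleftrightarrow> (v, w) \<in> F" for v w
    using F \<epsilon>(1) by (auto simp: link_matrix_def lag_poly no_loop)
  then show ?thesis using semistable by (intro bexI[of _ "(\<Phi>, \<omega>)"]) auto
qed

section \<open>Square systems indexed by a set of vertices\<close>

text \<open>Padding with the identity outside \<open>I\<close> makes the determinant that of the \<open>I \<times> I\<close> block, so square systems over
a subset of the vertices fit into matrices over the vertex type.\<close>

definition embed_matrix :: "'v set \<Rightarrow> ('v \<Rightarrow> 'v \<Rightarrow> 'a::zero_neq_one) \<Rightarrow> 'a^'v^'v" where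
  "embed_matrix I g = (\<chi> i j. if i \<in> I \<and> j \<in> I then g i j else of_bool (i = j))"

lemma det_embed_matrix_diagonal:
  fixes g :: "'v::finite \<Rightarrow> 'v \<Rightarrow> 'a::field"
  assumes "\<And>i j. i \<in> I \<Longrightarrow> j \<in> I \<Longrightarrow> g i j \<noteq> 0 \<longleftrightarrow> i = j"
  shows "det (embed_matrix I g) \<noteq> 0"
proof -
  have "det (embed_matrix I g) = (\<Prod>i\<in>UNIV. embed_matrix I g $ i $ i)"
    using assms by (intro det_diagonal) (auto simp: embed_matrix_def)
  also have "\<dots> \<noteq> 0" using assms by (simp add: embed_matrix_def)
  finally show ?thesis .
qed

lemma embed_matrix_mult:
  fixes g k :: "'v::finite \<Rightarrow> 'v \<Rightarrow> 'a::comm_ring_1"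
  shows "embed_matrix I g ** embed_matrix I k = embed_matrix I (\<lambda>i j. \<Sum>m\<in>I. g i m * k m j)"
proof -
  have "(\<Sum>m\<in>UNIV. embed_matrix I g $ i $ m * embed_matrix I k $ m $ j)
      = embed_matrix I (\<lambda>i j. \<Sum>m\<in>I. g i m * k m j) $ i $ j" for i j
  proof (cases "i \<in> I")
    case True
    have "(\<Sum>m\<in>UNIV. embed_matrix I g $ i $ m * embed_matrix I k $ m $ j)
        = (\<Sum>m\<in>I. embed_matrix I g $ i $ m * embed_matrix I k $ m $ j)"
      using True by (intro sum.mono_neutral_right) (auto simp: embed_matrix_def)
    also have "\<dots> = embed_matrix I (\<lambda>i j. \<Sum>m\<in>I. g i m * k m j) $ i $ j"
      using True by (cases "j \<in> I") (auto simp: embed_matrix_def intro!: sum.neutral)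
    finally show ?thesis .
  next
    case False
    have "(\<Sum>m\<in>UNIV. embed_matrix I g $ i $ m * embed_matrix I k $ m $ j)
        = (\<Sum>m\<in>{i}. embed_matrix I g $ i $ m * embed_matrix I k $ m $ j)"
      using False by (intro sum.mono_neutral_right) (auto simp: embed_matrix_def)
    also have "\<dots> = embed_matrix I (\<lambda>i j. \<Sum>m\<in>I. g i m * k m j) $ i $ j"
      using False by (simp add: embed_matrix_def)
    finally show ?thesis .
  qed
  then show ?thesis by (simp add: vec_eq_iff matrix_matrix_mult_def)
qed

lemma embed_matrix_vector:
  fixes g :: "'v::finite \<Rightarrow> 'v \<Rightarrow> 'a::comm_ring_1"
  shows "(embed_matrix I g *v x) $ i = (if i \<in> I then \<Sum>j\<in>I. g i j * x $ j else x $ i)"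
proof -
  have "(\<Sum>j\<in>UNIV. embed_matrix I g $ i $ j * x $ j)
      = (\<Sum>j\<in>(if i \<in> I then I else {i}). embed_matrix I g $ i $ j * x $ j)"
    by (intro sum.mono_neutral_right) (auto simp: embed_matrix_def)
  then show ?thesis by (auto simp: matrix_vector_mult_def embed_matrix_def)
qed

definition cramer_solution ::
    "'v::finite set \<Rightarrow> ('v \<Rightarrow> 'v \<Rightarrow> 'a::field) \<Rightarrow> ('v \<Rightarrow> 'a) \<Rightarrow> 'v \<Rightarrow> 'a" where
  "cramer_solution I g b k =
     det (\<chi> i j. if j = k then (if i \<in> I then b i else 0) else embed_matrix I g $ i $ j)
       / det (embed_matrix I g)"

text \<open>Outside \<open>I\<close> the padded system reads \<open>x\<^sub>k = 0\<close>, so it has the same solutions on \<open>I\<close> as the original one.\<close>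

lemma cramer_solution_iff:
  fixes g :: "'v::finite \<Rightarrow> 'v \<Rightarrow> 'a::field"
  assumes "det (embed_matrix I g) \<noteq> 0"
  shows "(\<forall>i\<in>I. (\<Sum>j\<in>I. g i j * x j) = b i) \<longleftrightarrow> (\<forall>k\<in>I. x k = cramer_solution I g b k)"
proof -
  let ?x = "\<chi> k. if k \<in> I then x k else 0" and ?b = "\<chi> i. if i \<in> I then b i else 0"
  have outside: "cramer_solution I g b k = 0" if "k \<notin> I" for k
  proof -
    let ?A = "\<chi> i j. if j = k then (if i \<in> I then b i else 0) else embed_matrix I g $ i $ j"
    have "row k ?A = 0" using that by (auto simp: row_def vec_eq_iff embed_matrix_def)
    then have "det ?A = 0" by (rule det_zero_row(2))
    then show ?thesis by (simp add: cramer_solution_def)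
  qed
  have "(\<forall>i\<in>I. (\<Sum>j\<in>I. g i j * x j) = b i) \<longleftrightarrow> embed_matrix I g *v ?x = ?b"
    by (auto simp: vec_eq_iff embed_matrix_vector)
  also have "\<dots> \<longleftrightarrow> ?x = (\<chi> k. cramer_solution I g b k)"
    unfolding cramer[OF assms] by (simp add: cramer_solution_def cong: if_cong)
  also have "\<dots> \<longleftrightarrow> (\<forall>k\<in>I. x k = cramer_solution I g b k)"
    using outside by (auto simp: vec_eq_iff)
  finally show ?thesis .
qed


section \<open>Direct and total effects\<close>

text \<open>With these matrices the observed processes can be treated as if they were driven by all internal spectra
at once: \<open>direct_effects\<close> are the ways in which a vertex \<open>t\<close>, observed or latent, enters the equation of an
observed process, and \<open>total_effects\<close> propagate them along the links among observed processes.\<close>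

definition direct_effects :: "'v::finite set \<Rightarrow> 'v set \<Rightarrow> ratfun^'v^'v \<Rightarrow> ratfun^'v^'v" where
  "direct_effects Ob La h = submat Ob Ob (mat 1) + submat La Ob h"

definition total_effects :: "'v::finite set \<Rightarrow> 'v set \<Rightarrow> ratfun^'v^'v \<Rightarrow> ratfun^'v^'v" where
  "total_effects Ob La h = direct_effects Ob La h ** matrix_inv (mat 1 - submat Ob Ob h)"

text \<open>The columns in \<open>B\<close> of \<open>I - H\<close>, and columns of the identity elsewhere.  Right multiplication by it
replaces total effects on \<open>B\<close> by direct effects.\<close>

definition undo_links :: "'v::finite set \<Rightarrow> 'v set \<Rightarrow> ratfun^'v^'v \<Rightarrow> ratfun^'v^'v" where
  "undo_links Ob B h = (\<chi> u w. of_bool (u = w) - (if w \<in> B then submat Ob Ob h $ u $ w else 0))"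

definition mixed_effects :: "'v::finite set \<Rightarrow> 'v set \<Rightarrow> 'v set \<Rightarrow> ratfun^'v^'v \<Rightarrow> ratfun^'v^'v" where
  "mixed_effects Ob La B h =
     (\<chi> u w. if w \<in> B then direct_effects Ob La h $ u $ w else total_effects Ob La h $ u $ w)"

lemma matrix_inv_eqI:
  fixes A B :: "'a::semiring_1^'n^'n"
  assumes "A ** B = mat 1" "B ** A = mat 1"
  shows "matrix_inv A = B"
proof -
  have "A ** matrix_inv A = mat 1 \<and> matrix_inv A ** A = mat 1"
    unfolding matrix_inv_def by (rule someI[of _ B]) (use assms in blast)
  then have "B ** (A ** matrix_inv A) = B" by simp
  then show ?thesis by (simp add: matrix_mul_assoc assms)
qed

lemma transpose_mult_diagonal_mult:
  fixes A S B :: "'a::comm_ring_1^'n::finite^'n"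
  assumes "\<And>i j. i \<noteq> j \<Longrightarrow> S $ i $ j = 0"
  shows "(transpose A ** S ** B) $ u $ w = (\<Sum>t\<in>UNIV. A $ t $ u * S $ t $ t * B $ t $ w)"
proof -
  have "(transpose A ** S) $ u $ t = A $ t $ u * S $ t $ t" for t
  proof -
    have "(\<Sum>k\<in>UNIV. A $ k $ u * S $ k $ t) = (\<Sum>k\<in>{t}. A $ k $ u * S $ k $ t)"
      using assms by (intro sum.mono_neutral_right) auto
    then show ?thesis by (simp add: matrix_matrix_mult_def transpose_def)
  qed
  then show ?thesis by (simp add: matrix_matrix_mult_def)
qed

locale latent_graph =
  fixes Ob La :: "'v::finite set" and D :: "('v \<times> 'v) set"
  assumes exogenous: "exogenous_latent_graph Ob La D"
    and acyclic: "acyclic D"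
begin

lemma vertices: "Ob \<union> La = UNIV" "Ob \<inter> La = {}"
  using exogenous by (auto simp: exogenous_latent_graph_def)

lemma no_edge_into_latent: "(u, w) \<in> D \<Longrightarrow> w \<in> Ob"
  using exogenous by (auto simp: exogenous_latent_graph_def)

lemma wf_edges: "wf D"
  by (simp add: finite_acyclic_wf acyclic)

end

locale linked_graph = latent_graph Ob La D for Ob La :: "'v::finite set" and D +
  fixes h :: "ratfun^'v^'v"
  assumes links: "\<And>u w. h $ u $ w \<noteq> 0 \<Longrightarrow> (u, w) \<in> D"
begin

abbreviation "obs_links \<equiv> submat Ob Ob h"
abbreviation "direct \<equiv> direct_effects Ob La h"
abbreviation "tot \<equiv> total_effects Ob La h"

lemma direct_nth: "direct $ t $ b = (if b \<in> Ob then if t \<in> Ob then of_bool (t = b) else h $ t $ b else 0)"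
  using vertices by (auto simp: direct_effects_def submat_def mat_def)

text \<open>A vector \<open>x\<close> in the kernel satisfies \<open>x\<^sub>u = \<Sum>\<^sub>w H\<^sub>u\<^sub>w x\<^sub>w\<close>, where only children \<open>w\<close> of \<open>u\<close> occur; it vanishes by induction
against the edges of the acyclic graph.\<close>

lemma invertible_obs: "invertible (mat 1 - obs_links)"
proof -
  have "x = 0" if x: "(mat 1 - obs_links) *v x = 0" for x
  proof -
    have rec: "x $ u = (\<Sum>w\<in>UNIV. obs_links $ u $ w * x $ w)" for u
    proof -
      have "((mat 1 - obs_links) *v x) $ u = 0" using x by simp
      then show ?thesis by (simp add: matrix_vector_mult_diff_rdistrib) (simp add: matrix_vector_mult_def)
    qed
    have "wf (D\<inverse>)" by (simp add: finite_acyclic_wf_converse acyclic)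
    then have "x $ u = 0" for u
    proof (induction u rule: wf_induct_rule)
      case (less u)
      have "obs_links $ u $ w * x $ w = 0" for w
        using less[of w] links[of u w] by (auto simp: submat_def)
      then show ?case unfolding rec[of u] by (intro sum.neutral) blast
    qed
    then show ?thesis by (simp add: vec_eq_iff)
  qed
  then have "\<exists>B. B ** (mat 1 - obs_links) = mat 1"
    by (intro iffD2[OF matrix_left_invertible_ker] allI impI)
  then obtain B where "B ** (mat 1 - obs_links) = mat 1" ..
  moreover from this have "(mat 1 - obs_links) ** B = mat 1"
    by (rule matrix_left_right_inverse1)
  ultimately show ?thesis
    unfolding invertible_def by (intro exI[of _ B] conjI)
qed

lemma obs_inverse:
  "(mat 1 - obs_links) ** matrix_inv (mat 1 - obs_links) = mat 1"
  "matrix_inv (mat 1 - obs_links) ** (mat 1 - obs_links) = mat 1"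
  using someI_ex[OF invertible_obs[unfolded invertible_def]] unfolding matrix_inv_def by auto

text \<open>The total effect decomposed by the last edge of the paths.  All later facts on total effects follow from
this recursion by induction along the acyclic graph.\<close>

lemma total_nth:
  "tot $ t $ b = direct $ t $ b + (\<Sum>c\<in>parents_in D Ob {b}. tot $ t $ c * h $ c $ b)"
proof -
  have "tot ** (mat 1 - obs_links) = direct"
    unfolding total_effects_def by (simp add: matrix_mul_assoc[symmetric] obs_inverse)
  then have "(\<Sum>c\<in>UNIV. tot $ t $ c * (of_bool (c = b) - obs_links $ c $ b)) = direct $ t $ b"
    by (simp add: vec_eq_iff matrix_matrix_mult_def mat_def of_bool_def)
  moreover have "(\<Sum>c\<in>UNIV. tot $ t $ c * of_bool (c = b)) = tot $ t $ b"
    by (simp add: of_bool_def if_distrib cong: if_cong)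
  ultimately have "tot $ t $ b = direct $ t $ b + (tot ** obs_links) $ t $ b"
    by (simp add: right_diff_distrib sum_subtractf matrix_matrix_mult_def diff_eq_eq del: sum_mult_of_bool_eq)
  also have "(tot ** obs_links) $ t $ b = (\<Sum>c\<in>parents_in D Ob {b}. tot $ t $ c * obs_links $ c $ b)"
    unfolding matrix_matrix_mult_def vec_lambda_beta using links
    by (intro sum.mono_neutral_right) (auto simp: parents_in_def submat_def)
  also have "\<dots> = (\<Sum>c\<in>parents_in D Ob {b}. tot $ t $ c * h $ c $ b)"
    by (intro sum.cong) (auto simp: parents_in_def submat_def dest: no_edge_into_latent)
  finally show ?thesis .
qed

lemma total_undo_links: "tot ** undo_links Ob B h = mixed_effects Ob La B h"
proof -
  have "(\<Sum>c\<in>UNIV. tot $ t $ c * undo_links Ob B h $ c $ b) = mixed_effects Ob La B h $ t $ b" for t b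
  proof -
    have "(\<Sum>c\<in>UNIV. tot $ t $ c * undo_links Ob B h $ c $ b)
      = tot $ t $ b - (\<Sum>c\<in>UNIV. tot $ t $ c * (if b \<in> B then obs_links $ c $ b else 0))"
    proof -
      have "(\<Sum>c\<in>UNIV. tot $ t $ c * of_bool (c = b)) = tot $ t $ b"
        by (simp add: of_bool_def if_distrib cong: if_cong)
      then show ?thesis
        by (simp add: undo_links_def right_diff_distrib sum_subtractf del: sum_mult_of_bool_eq)
    qed
    also have "(\<Sum>c\<in>UNIV. tot $ t $ c * (if b \<in> B then obs_links $ c $ b else 0))
      = (if b \<in> B then \<Sum>c\<in>parents_in D Ob {b}. tot $ t $ c * h $ c $ b else 0)"
    proof (cases "b \<in> B")
      case True
      have "(\<Sum>c\<in>UNIV. tot $ t $ c * obs_links $ c $ b)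
          = (\<Sum>c\<in>parents_in D Ob {b}. tot $ t $ c * obs_links $ c $ b)"
        using links by (intro sum.mono_neutral_right) (auto simp: parents_in_def submat_def)
      also have "\<dots> = (\<Sum>c\<in>parents_in D Ob {b}. tot $ t $ c * h $ c $ b)"
        by (intro sum.cong) (auto simp: parents_in_def submat_def dest: no_edge_into_latent)
      finally show ?thesis using True by simp
    qed simp
    finally show ?thesis
      using total_nth[of t b] by (simp add: mixed_effects_def)
  qed
  then show ?thesis by (simp add: vec_eq_iff matrix_matrix_mult_def)
qed

lemma direct_support: "direct $ t $ b \<noteq> 0 \<Longrightarrow> (t, b) \<in> {(u, w). h $ u $ w \<noteq> 0}\<^sup>*"
  by (auto simp: direct_nth split: if_splits)

lemma total_support: "tot $ t $ b \<noteq> 0 \<Longrightarrow> (t, b) \<in> {(u, w). h $ u $ w \<noteq> 0}\<^sup>*"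
  using wf_edges
proof (induction b rule: wf_induct_rule)
  case (less b)
  show ?case
  proof (cases "direct $ t $ b = 0")
    case True
    then have "(\<Sum>c\<in>parents_in D Ob {b}. tot $ t $ c * h $ c $ b) \<noteq> 0"
      using less.prems total_nth[of t b] by simp
    then obtain c where "c \<in> parents_in D Ob {b}" "tot $ t $ c * h $ c $ b \<noteq> 0"
      by (rule sum.not_neutral_contains_not_neutral)
    then show ?thesis
      using less.IH[of c] by (auto simp: parents_in_def intro: rtrancl_into_rtrancl)
  qed (rule direct_support)
qed

lemma mixed_support: "mixed_effects Ob La B h $ t $ b \<noteq> 0 \<Longrightarrow> (t, b) \<in> {(u, w). h $ u $ w \<noteq> 0}\<^sup>*"
  using direct_support[of t b] total_support[of t b] by (auto simp: mixed_effects_def split: if_splits)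

text \<open>transport along an unbranched path\<close>

text \<open>Where every vertex has at most one incoming link with nonzero coefficient, nothing can cancel: there is exactly one
directed path from the root \<open>t\<close> to \<open>b\<close>, and the total effect is the product of the links on it.\<close>

lemma total_nonzero_along_path:
  assumes pred: "\<And>u u' w. h $ u $ w \<noteq> 0 \<Longrightarrow> h $ u' $ w \<noteq> 0 \<Longrightarrow> u = u'"
    and root: "\<And>u. h $ u $ t = 0"
    and path: "(t, b) \<in> {(u, w). h $ u $ w \<noteq> 0}\<^sup>*" and b: "b \<in> Ob"
  shows "tot $ t $ b \<noteq> 0"
  using path b
proof (induction rule: rtrancl_induct)
  case base
  then have "tot $ t $ t = 1" by (subst total_nth) (simp add: direct_nth root)
  then show ?case by simp
next
  case (step c b)
  then have cb: "h $ c $ b \<noteq> 0" by simp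
  have "b \<noteq> t" using cb root by auto
  show ?case
  proof (cases "c \<in> Ob")
    case True
    then have "direct $ t $ b = 0"
      using pred[OF cb, of t] \<open>b \<noteq> t\<close> by (auto simp: direct_nth)
    moreover have "(\<Sum>u\<in>parents_in D Ob {b}. tot $ t $ u * h $ u $ b)
        = (\<Sum>u\<in>{c}. tot $ t $ u * h $ u $ b)"
      using True links[OF cb] pred[OF cb]
      by (intro sum.mono_neutral_right) (auto simp: parents_in_def)
    ultimately have "tot $ t $ b = tot $ t $ c * h $ c $ b"
      by (subst total_nth) simp
    then show ?thesis using step.IH True cb by simp
  next
    case False
    have "t = c"
      using step.hyps(1) False by (cases rule: rtranclE) (use links[of _ c] no_edge_into_latent[of _ c] in auto)
    then have "direct $ t $ b = h $ c $ b"
      using False step.prems by (simp add: direct_nth)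
    moreover have "(\<Sum>u\<in>parents_in D Ob {b}. tot $ t $ u * h $ u $ b) = 0"
      using False pred[OF cb] by (intro sum.neutral) (auto simp: parents_in_def)
    ultimately show ?thesis using cb by (subst total_nth) simp
  qed
qed

end

section \<open>The spectrum in terms of total effects\<close>

text \<open>The projected internal spectrum is \<open>a\<^sup>T diag(s) a\<^sup>*\<close> for the direct effects \<open>a\<close>: an observed \<open>t\<close>
contributes its own diagonal entry, and a latent \<open>t\<close> its links into the observed processes.\<close>

lemma (in latent_graph) observed_spectrum_factorization:
  assumes E: "E \<in> ts_graphs_of D"
  shows "observed_spectrum Ob La E \<theta> =
    transpose (total_effects Ob La (link_matrix E \<theta>)) ** internal_spectrum E \<theta>
      ** map_matrix star (total_effects Ob La (link_matrix E \<theta>))"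
proof -
  let ?h = "link_matrix E \<theta>" and ?s = "internal_spectrum E \<theta>"
  interpret linked_graph Ob La D ?h
    using E by unfold_locales (auto simp: link_matrix_def ts_graphs_of_def split: if_splits)
  let ?P = "matrix_inv (mat 1 - obs_links)"
  have star_1_minus: "map_matrix star (mat 1 - obs_links) = mat 1 - map_matrix star obs_links"
    by (simp add: vec_eq_iff mat_def)
  have star_inv: "matrix_inv (mat 1 - map_matrix star obs_links) = map_matrix star ?P"
    unfolding star_1_minus[symmetric]
    by (intro matrix_inv_eqI) (simp_all add: obs_inverse flip: map_matrix_star_mult)
  have "projected_internal_spectrum Ob La E \<theta> = transpose direct ** ?s ** map_matrix star direct"
  proof -
    have diag: "?s $ i $ j = 0" "submat La La ?s $ i $ j = 0" if "i \<noteq> j" for i j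
      using that by (auto simp: internal_spectrum_def submat_def)
    have "projected_internal_spectrum Ob La E \<theta> $ u $ w
        = (transpose direct ** ?s ** map_matrix star direct) $ u $ w" for u w
    proof -
      have "(transpose (submat La Ob ?h) ** submat La La ?s ** map_matrix star (submat La Ob ?h)) $ u $ w
        = (\<Sum>t\<in>UNIV. submat La Ob ?h $ t $ u * submat La La ?s $ t $ t
              * map_matrix star (submat La Ob ?h) $ t $ w)"
        by (rule transpose_mult_diagonal_mult) (rule diag)
      also have "\<dots> = (\<Sum>t\<in>La. direct $ t $ u * ?s $ t $ t * star (direct $ t $ w))"
        using vertices by (intro sum.mono_neutral_cong_right) (auto simp: submat_def direct_nth)
      finally have La: "(transpose (submat La Ob ?h) ** submat La La ?s ** map_matrix star (submat La Ob ?h)) $ u $ w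
        = (\<Sum>t\<in>La. direct $ t $ u * ?s $ t $ t * star (direct $ t $ w))" .
      have "(\<Sum>t\<in>Ob. direct $ t $ u * ?s $ t $ t * star (direct $ t $ w))
          = (\<Sum>t\<in>Ob. if t = u then submat Ob Ob ?s $ u $ w else 0)"
        using diag(1)[of u w] by (intro sum.cong) (auto simp: submat_def direct_nth)
      also have "\<dots> = submat Ob Ob ?s $ u $ w" by (simp add: submat_def)
      finally have Ob: "(\<Sum>t\<in>Ob. direct $ t $ u * ?s $ t $ t * star (direct $ t $ w))
          = submat Ob Ob ?s $ u $ w" .
      have "(transpose direct ** ?s ** map_matrix star direct) $ u $ w
        = (\<Sum>t\<in>Ob \<union> La. direct $ t $ u * ?s $ t $ t * star (direct $ t $ w))"
        by (subst transpose_mult_diagonal_mult[OF diag(1)]) (simp_all add: vertices)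
      also have "\<dots> = submat Ob Ob ?s $ u $ w + (\<Sum>t\<in>La. direct $ t $ u * ?s $ t $ t * star (direct $ t $ w))"
        using vertices by (subst sum.union_disjoint) (simp_all add: Ob)
      finally show ?thesis by (simp add: projected_internal_spectrum_def La)
    qed
    then show ?thesis by (simp add: vec_eq_iff)
  qed
  then show ?thesis
    unfolding observed_spectrum_def total_effects_def
    by (simp add: star_inv map_matrix_star_mult matrix_transpose_mul matrix_mul_assoc)
qed

lemma (in latent_graph) linked_graph_link_matrix:
  "E \<in> ts_graphs_of D \<Longrightarrow> linked_graph Ob La D (link_matrix E \<theta>)"
  by unfold_locales (auto simp: link_matrix_def ts_graphs_of_def split: if_splits)

lemma internal_spectrum_star: "map_matrix star (internal_spectrum E \<theta>) = transpose (internal_spectrum E \<theta>)"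
  by (auto simp: vec_eq_iff internal_spectrum_def transpose_def)

lemma (in latent_graph) observed_spectrum_star:
  assumes "E \<in> ts_graphs_of D"
  shows "map_matrix star (observed_spectrum Ob La E \<theta>) = transpose (observed_spectrum Ob La E \<theta>)"
proof -
  let ?r = "total_effects Ob La (link_matrix E \<theta>)"
  have "map_matrix star (map_matrix star ?r) = ?r"
    "map_matrix star (transpose ?r) = transpose (map_matrix star ?r)"
    by (simp_all add: vec_eq_iff transpose_def)
  then show ?thesis
    unfolding observed_spectrum_factorization[OF assms]
    by (simp add: map_matrix_star_mult internal_spectrum_star matrix_transpose_mul matrix_mul_assoc)
qed

lemma (in latent_graph) param_rational_direct:
  assumes "E \<in> ts_graphs_of D"
  shows "param_rational Ob' E (\<lambda>\<theta>. direct_effects Ob La (link_matrix E \<theta>) $ t $ b)"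
  using assms by (cases "b \<in> Ob"; cases "t \<in> Ob")
    (auto simp: linked_graph.direct_nth[OF linked_graph_link_matrix[OF assms]] ts_graphs_of_def
      intro: param_rational.const param_rational_link_matrix)

lemma (in latent_graph) param_rational_total:
  assumes "E \<in> ts_graphs_of D"
  shows "param_rational Ob' E (\<lambda>\<theta>. total_effects Ob La (link_matrix E \<theta>) $ t $ b)"
  using wf_edges
proof (induction b rule: wf_induct_rule)
  case (less b)
  have E: "time_series_graph E" using assms by (simp add: ts_graphs_of_def)
  show ?case
    unfolding linked_graph.total_nth[OF linked_graph_link_matrix[OF assms], of _ t b]
    by (intro E param_rational.add param_rational_sum param_rational.mult param_rational_direct assms
        param_rational_link_matrix less) (auto simp: parents_in_def)
qed

lemma (in latent_graph) param_rational_mixed: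
  assumes "E \<in> ts_graphs_of D"
  shows "param_rational Ob' E (\<lambda>\<theta>. mixed_effects Ob La B (link_matrix E \<theta>) $ t $ b)"
  using param_rational_total[OF assms] param_rational_direct[OF assms]
  by (cases "b \<in> B") (auto simp: mixed_effects_def)


section \<open>Path systems\<close>

definition path_edges :: "'a list \<Rightarrow> ('a \<times> 'a) set" where
  "path_edges p = set (zip p (tl p))"

lemma path_edges_simps [simp]:
  "path_edges [] = {}" "path_edges [x] = {}"
  "path_edges (x # y # p) = insert (x, y) (path_edges (y # p))"
  by (simp_all add: path_edges_def)

lemma path_edges_in: "(u, w) \<in> path_edges p \<Longrightarrow> u \<in> set p \<and> w \<in> set (tl p)"
  unfolding path_edges_def by (auto dest: set_zip_leftD set_zip_rightD)

lemma directed_path_edges: "directed_path D p \<Longrightarrow> path_edges p \<subseteq> D"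
  by (induction p rule: induct_list012) (auto simp: directed_path_def)

lemma path_edges_rtrancl: "p \<noteq> [] \<Longrightarrow> (hd p, last p) \<in> (path_edges p)\<^sup>*"
proof (induction p rule: induct_list012)
  case (3 x y p)
  then have "(y, last (y # p)) \<in> (path_edges (x # y # p))\<^sup>*"
    using rtrancl_mono[of "path_edges (y # p)" "path_edges (x # y # p)"] by fastforce
  then show ?case by (auto intro: converse_rtrancl_into_rtrancl)
qed auto

lemma directed_path_trancl: "directed_path D (x # p) \<Longrightarrow> y \<in> set p \<Longrightarrow> (x, y) \<in> D\<^sup>+"
proof (induction p arbitrary: x)
  case (Cons z p)
  then show ?case by (auto simp: directed_path_def intro: trancl_into_trancl2)
qed simp

lemma directed_path_distinct: "acyclic D \<Longrightarrow> directed_path D p \<Longrightarrow> distinct p"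
proof (induction p)
  case (Cons x p)
  have "x \<notin> set p" using directed_path_trancl[of D x p x] Cons.prems by (auto simp: acyclic_def)
  moreover have "distinct p"
    using Cons by (cases p) (auto simp: directed_path_def)
  ultimately show ?case by simp
qed simp

lemma path_edges_unique_pred:
  "distinct p \<Longrightarrow> (u, w) \<in> path_edges p \<Longrightarrow> (u', w) \<in> path_edges p \<Longrightarrow> u = u'"
  by (induction p rule: induct_list012) (auto dest: path_edges_in)

lemma path_edges_hd: "distinct p \<Longrightarrow> (u, hd p) \<notin> path_edges p"
  by (cases p) (auto dest: path_edges_in)

text \<open>If exactly the edges of a family of vertex-disjoint paths carry nonzero links, then the first vertex of a path
affects the last vertex of the same path and the last vertex of no other one.  This holds for direct effects
as well as for total effects, provided that the paths ending in \<open>B\<close> are short enough for the direct effect to see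
the whole path.\<close>

lemma (in linked_graph) disjoint_paths_effects:
  assumes paths: "\<And>i. i \<in> I \<Longrightarrow> directed_path D (p i)"
    and disjoint: "\<And>i j. i \<in> I \<Longrightarrow> j \<in> I \<Longrightarrow> i \<noteq> j \<Longrightarrow> set (p i) \<inter> set (p j) = {}"
    and support: "\<And>u w. h $ u $ w \<noteq> 0 \<longleftrightarrow> (u, w) \<in> (\<Union>i\<in>I. path_edges (p i))"
    and i: "i \<in> I" and j: "j \<in> I" and last: "last (p j) \<in> Ob"
    and B: "last (p j) \<in> B \<Longrightarrow> p j = [last (p j)] \<or> (\<exists>l\<in>La. p j = [l, last (p j)])"
  shows "mixed_effects Ob La B h $ hd (p i) $ last (p j) \<noteq> 0 \<longleftrightarrow> i = j"
proof
  have ne: "p k \<noteq> []" and dist: "distinct (p k)" if "k \<in> I" for k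
    using paths[OF that] directed_path_distinct[OF acyclic] by (auto simp: directed_path_def)
  let ?F = "{(u, w). h $ u $ w \<noteq> 0}"
  have F: "?F = (\<Union>i\<in>I. path_edges (p i))" using support by auto
  show "i = j" if "mixed_effects Ob La B h $ hd (p i) $ last (p j) \<noteq> 0"
  proof -
    have "x \<in> set (p i)" if "(hd (p i), x) \<in> ?F\<^sup>*" for x
      using that
    proof (induction rule: rtrancl_induct)
      case base
      then show ?case using ne[OF i] by simp
    next
      case (step x y)
      then obtain k where k: "k \<in> I" "(x, y) \<in> path_edges (p k)" using F by auto
      then have "k = i" using step.IH path_edges_in[OF k(2)] disjoint i by fastforce
      then show ?case using path_edges_in[OF k(2)] by (auto dest: list.set_sel(2)[rotated])
    qed
    then have "last (p j) \<in> set (p i)" using mixed_support[OF that] by blast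
    then have "set (p i) \<inter> set (p j) \<noteq> {}" using ne[OF j] by auto
    then show ?thesis using disjoint[OF i j] by blast
  qed
  assume "i = j"
  show "mixed_effects Ob La B h $ hd (p i) $ last (p j) \<noteq> 0"
  proof (cases "last (p j) \<in> B")
    case True
    have "direct $ hd (p j) $ last (p j) \<noteq> 0"
      using B[OF True]
    proof
      assume "p j = [last (p j)]"
      then have "hd (p j) = last (p j)" by (metis list.sel(1))
      then show ?thesis using last by (simp add: direct_nth)
    next
      assume "\<exists>l\<in>La. p j = [l, last (p j)]"
      then obtain l where l: "l \<in> La" "p j = [l, last (p j)]" by blast
      then have "(l, last (p j)) \<in> path_edges (p j)" by (metis path_edges_simps(3) insertI1)
      then have "h $ l $ last (p j) \<noteq> 0" using support j by blast
      moreover have "hd (p j) = l" using l(2) by (metis list.sel(1))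
      ultimately show ?thesis using l(1) last vertices by (auto simp: direct_nth)
    qed
    then show ?thesis using True \<open>i = j\<close> by (simp add: mixed_effects_def)
  next
    case False
    have "tot $ hd (p j) $ last (p j) \<noteq> 0"
    proof (rule total_nonzero_along_path)
      show "u = u'" if h: "h $ u $ w \<noteq> 0" "h $ u' $ w \<noteq> 0" for u u' w
      proof -
        obtain k k' where k: "k \<in> I" "(u, w) \<in> path_edges (p k)" "k' \<in> I" "(u', w) \<in> path_edges (p k')"
          using support[of u w] support[of u' w] h by auto
        then have "w \<in> set (p k) \<inter> set (p k')"
          using path_edges_in[OF k(2)] path_edges_in[OF k(4)] ne by (auto intro: list.set_sel(2))
        then have "k = k'" using disjoint k by blast
        then show ?thesis using path_edges_unique_pred dist k by metis
      qed
      show "h $ u $ hd (p j) = 0" for u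
      proof (rule ccontr)
        assume "h $ u $ hd (p j) \<noteq> 0"
        then obtain k where k: "k \<in> I" "(u, hd (p j)) \<in> path_edges (p k)" using support by auto
        then have "hd (p j) \<in> set (p k) \<inter> set (p j)"
          using path_edges_in[OF k(2)] ne[OF k(1)] ne[OF j] by (auto intro: list.set_sel(2))
        then have "k = j" using disjoint k(1) j by blast
        then show False using path_edges_hd[OF dist[OF j]] k by blast
      qed
      have "path_edges (p j) \<subseteq> ?F" using F j by blast
      then show "(hd (p j), last (p j)) \<in> ?F\<^sup>*"
        using path_edges_rtrancl[OF ne[OF j]] rtrancl_mono by blast
    qed (rule last)
    then show ?thesis using False \<open>i = j\<close> by (simp add: mixed_effects_def)
  qed
qed

section \<open>The latent factor half-trek criterion\<close>

text \<open>The half-treks of the criterion, indexed by their sources \<open>y \<in> Y\<close>: \<open>Lf y\<close> and \<open>Rt y\<close> are the two sides of the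
half-trek that starts at \<open>y\<close>.  Using \<open>Y\<close> to index tops and targets too turns all matrices of the proof into
square matrices over \<open>Y\<close>.\<close>

locale half_trek_system = latent_graph Ob La D for Ob La :: "'v::finite set" and D +
  fixes v :: 'v and Y W L' :: "'v set" and Lf Rt :: "'v \<Rightarrow> 'v list"
  assumes v: "v \<in> Ob" and Y: "Y \<subseteq> Ob - {v}" and W: "W \<subseteq> Ob - {v}" and L': "L' \<subseteq> La"
    and card_W: "card W = card L'" and W_parents: "W \<inter> parents_in D Ob {v} = {}"
    and Y_W: "Y \<inter> W = {}"
    and common_latent: "parents_in D La Y \<inter> parents_in D La (W \<union> {v}) \<subseteq> L'"
    and left_path: "\<And>y. y \<in> Y \<Longrightarrow> directed_path D (Lf y)"
    and left_form: "\<And>y. y \<in> Y \<Longrightarrow> Lf y = [y] \<or> (\<exists>l\<in>La. Lf y = [l, y])"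
    and left_disjoint: "\<And>y y'. y \<in> Y \<Longrightarrow> y' \<in> Y \<Longrightarrow> y \<noteq> y' \<Longrightarrow> set (Lf y) \<inter> set (Lf y') = {}"
    and right_path: "\<And>y. y \<in> Y \<Longrightarrow> directed_path D (Rt y)"
    and same_top: "\<And>y. y \<in> Y \<Longrightarrow> hd (Rt y) = hd (Lf y)"
    and right_disjoint: "\<And>y y'. y \<in> Y \<Longrightarrow> y' \<in> Y \<Longrightarrow> y \<noteq> y' \<Longrightarrow> set (Rt y) \<inter> set (Rt y') = {}"
    and targets: "bij_betw (\<lambda>y. last (Rt y)) Y (parents_in D Ob {v} \<union> W)"
    and right_form: "\<And>y. y \<in> Y \<Longrightarrow> last (Rt y) \<in> W \<Longrightarrow> \<exists>l\<in>L'. Rt y = [l, last (Rt y)]"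

lemma lf_htc_half_trek_system:
  assumes "exogenous_latent_graph Ob La D" "acyclic D" "v \<in> Ob" "Y \<subseteq> Ob - {v}" "W \<subseteq> Ob - {v}"
    "L' \<subseteq> La" "lf_htc Ob La D v Y W L'"
  shows "\<exists>Lf Rt. half_trek_system Ob La D v Y W L' Lf Rt"
proof -
  let ?J = "parents_in D Ob {v} \<union> W"
  obtain T where T: "trek_system D Y ?J T" and half: "\<And>\<tau>. \<tau> \<in> T \<Longrightarrow> lf_half_trek Ob La D \<tau>"
    and sided: "no_sided_intersection T"
    and W_form: "\<And>\<tau>. \<tau> \<in> T \<Longrightarrow> trek_target \<tau> \<in> W \<Longrightarrow>
      (\<exists>y\<in>Y. \<exists>l\<in>L'. \<tau> = ([l, y], l, [l, trek_target \<tau>]))"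
    using assms(7) unfolding lf_htc_def by blast
  define trek where "trek = the_inv_into T trek_source"
  have source: "bij_betw trek_source T Y" and target: "bij_betw trek_target T ?J"
    using T by (auto simp: trek_system_def)
  then have trek: "bij_betw trek Y T"
    unfolding trek_def by (intro bij_betw_the_inv_into)
  have trek_in: "trek y \<in> T" and trek_source: "trek_source (trek y) = y" if "y \<in> Y" for y
    using that source bij_betwE[OF trek] f_the_inv_into_f_bij_betw[OF source]
    by (auto simp: trek_def)
  have trek_neq: "trek y \<noteq> trek y'" if "y \<in> Y" "y' \<in> Y" "y \<noteq> y'" for y y'
    using that trek_source by metis
  define Lf where "Lf y = fst (trek y)" for y
  define Rt where "Rt y = snd (snd (trek y))" for y
  have sets: "left_set (trek y) = set (Lf y)" "right_set (trek y) = set (Rt y)"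
    "trek_target (trek y) = last (Rt y)" "trek_source (trek y) = last (Lf y)" for y
    by (simp_all add: Lf_def Rt_def left_set_def right_set_def trek_target_def trek_source_def
        case_prod_unfold)
  have "half_trek_system Ob La D v Y W L' Lf Rt"
  proof unfold_locales
    show "directed_path D (Lf y)" "directed_path D (Rt y)" "hd (Rt y) = hd (Lf y)" if "y \<in> Y" for y
      using half[OF trek_in[OF that]]
      by (auto simp: lf_half_trek_def is_trek_def Lf_def Rt_def case_prod_unfold)
    show "Lf y = [y] \<or> (\<exists>l\<in>La. Lf y = [l, y])" if "y \<in> Y" for y
      using half[OF trek_in[OF that]] trek_source[OF that]
      by (auto simp: lf_half_trek_def Lf_def trek_source_def)
    show "set (Lf y) \<inter> set (Lf y') = {}" "set (Rt y) \<inter> set (Rt y') = {}"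
      if "y \<in> Y" "y' \<in> Y" "y \<noteq> y'" for y y'
      using sided trek_in that trek_neq[OF that] unfolding no_sided_intersection_def
      by (metis sets)+
    have "bij_betw (trek_target \<circ> trek) Y ?J" by (rule bij_betw_trans[OF trek target])
    then show "bij_betw (\<lambda>y. last (Rt y)) Y ?J" by (simp add: sets comp_def)
    show "\<exists>l\<in>L'. Rt y = [l, last (Rt y)]" if "y \<in> Y" "last (Rt y) \<in> W" for y
    proof -
      have "trek_target (trek y) \<in> W" using that(2) by (simp add: sets)
      from W_form[OF trek_in[OF that(1)] this] obtain u l where
        "l \<in> L'" "trek y = ([l, u], l, [l, trek_target (trek y)])" by blast
      then have "snd (snd (trek y)) = [l, trek_target (trek y)]" by (metis snd_conv)
      then show ?thesis using \<open>l \<in> L'\<close> sets(3)[of y] by (auto simp: Rt_def)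
    qed
  qed (use assms in \<open>auto simp: lf_htc_def\<close>)
  then show ?thesis by blast
qed

context half_trek_system
begin

abbreviation "apex y \<equiv> hd (Lf y)"
abbreviation "target y \<equiv> last (Rt y)"
abbreviation "origin j \<equiv> inv_into Y (\<lambda>y. last (Rt y)) j"
abbreviation "pa \<equiv> parents_in D Ob {v}"
text \<open>The elements of \<open>Y\<close> whose incoming links have to be undone, because half-treks avoiding \<open>L'\<close> reach them from
\<open>W \<union> {v}\<close>.\<close>

definition Y_htr where "Y_htr = Y \<inter> htr Ob La D L' (W \<union> {v})"

lemma origin: "j \<in> pa \<union> W \<Longrightarrow> origin j \<in> Y" "j \<in> pa \<union> W \<Longrightarrow> target (origin j) = j"
  "y \<in> Y \<Longrightarrow> origin (target y) = y"
  using targets bij_betwE[OF bij_betw_inv_into[OF targets]]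
    bij_betw_inv_into_right[OF targets] bij_betw_inv_into_left[OF targets] by auto

lemma target_in: "y \<in> Y \<Longrightarrow> target y \<in> pa \<union> W"
  using bij_betwE[OF targets] by blast

lemma target_observed: "y \<in> Y \<Longrightarrow> target y \<in> Ob"
  using target_in W by (fastforce simp: parents_in_def)

lemma left_last: "y \<in> Y \<Longrightarrow> last (Lf y) = y"
  using left_form by force

lemma top_inj: "inj_on (\<lambda>y. hd (Lf y)) Y"
proof (rule inj_onI, rule ccontr)
  fix y y' assume *: "y \<in> Y" "y' \<in> Y" "apex y = apex y'" "y \<noteq> y'"
  then have "Lf y \<noteq> []" "Lf y' \<noteq> []" using left_path by (auto simp: directed_path_def)
  then have "apex y \<in> set (Lf y) \<inter> set (Lf y')" using *(3) by (metis IntI hd_in_set)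
  then show False using left_disjoint * by blast
qed

text \<open>The half-treks ending in \<open>W\<close> have their tops in \<open>L'\<close>, and \<open>W\<close> and \<open>L'\<close> are equally large; hence the square
matrix of the links from these tops to \<open>W\<close> involves all of \<open>L'\<close>.\<close>

lemma tops_of_W: "(\<lambda>w. apex (origin w)) ` W = L'"
proof (rule card_subset_eq)
  have top: "apex (origin w) \<in> L'" if "w \<in> W" for w
  proof -
    have y: "origin w \<in> Y" "target (origin w) = w" using origin that by auto
    have "\<exists>l\<in>L'. Rt (origin w) = [l, w]" using right_form[OF y(1)] y(2) that by simp
    then obtain l where "l \<in> L'" "Rt (origin w) = [l, w]" by blast
    then show ?thesis using same_top[OF y(1)] by simp
  qed
  then show "(\<lambda>w. apex (origin w)) ` W \<subseteq> L'" by blast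
  have "inj_on (\<lambda>w. apex (origin w)) W"
  proof (rule inj_onI)
    fix w w' assume *: "w \<in> W" "w' \<in> W" "apex (origin w) = apex (origin w')"
    then have "origin w = origin w'" using inj_onD[OF top_inj] origin(1) by blast
    then show "w = w'" using * origin(2) by (metis UnI2)
  qed
  then show "card ((\<lambda>w. apex (origin w)) ` W) = card L'"
    using card_W by (simp add: card_image)
qed simp

lemma directed_path_in_observed: "directed_path D (t # p) \<Longrightarrow> set p \<subseteq> Ob"
  by (induction p arbitrary: t) (auto simp: directed_path_def dest: no_edge_into_latent)

lemma rtrancl_directed_path:
  "(t, y) \<in> R\<^sup>* \<Longrightarrow> \<exists>p. directed_path R (t # p) \<and> last (t # p) = y"
proof (induction rule: converse_rtrancl_induct)
  case base
  then show ?case by (intro exI[of _ "[]"]) (simp add: directed_path_def)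
next
  case (step t u)
  then obtain p where "directed_path R (u # p)" "last (u # p) = y" by blast
  then show ?case using step.hyps by (intro exI[of _ "u # p"]) (simp add: directed_path_def)
qed

text \<open>The half-trek consists of the edge from \<open>t\<close> to \<open>a\<close>, if \<open>t\<close> is latent, and of a directed path from \<open>t\<close> to \<open>y\<close>.
That path stays in \<open>Ob\<close> after \<open>t\<close> because no edge enters a latent vertex, so it cannot meet \<open>L'\<close>.\<close>

lemma reachable_in_htr:
  assumes a: "a \<in> W \<union> {v}" and y: "y \<in> Y" and t: "t = a \<or> t \<in> La - L' \<and> (t, a) \<in> D"
    and reach: "(t, y) \<in> D\<^sup>*"
  shows "y \<in> htr Ob La D L' (W \<union> {v})"
proof -
  have a_obs: "a \<in> Ob" and y_obs: "y \<in> Ob" using a y v W Y by auto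
  have "t \<noteq> y" using t y_obs vertices(2) a y Y Y_W by auto
  obtain p where p: "directed_path D (t # p)" "last (t # p) = y"
    using rtrancl_directed_path[OF reach] by blast
  then have "p \<noteq> []" using \<open>t \<noteq> y\<close> by auto
  then obtain xs where xs: "p = xs @ [y]" using p(2) by (metis append_butlast_last_id last_ConsR)
  have obs: "set xs \<subseteq> Ob" using directed_path_in_observed[OF p(1)] xs by auto
  have no_L': "x \<notin> L'" if "x \<in> Ob" for x using that L' vertices by auto
  define \<tau> where "\<tau> = (if t = a then [a] else [t, a], t, t # xs @ [y])"
  have "is_trek D \<tau>"
    using p(1) t by (auto simp: \<tau>_def is_trek_def xs directed_path_def)
  then have "lf_half_trek Ob La D \<tau>"
    unfolding lf_half_trek_def using a_obs y_obs obs t by (auto simp: \<tau>_def)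
  moreover have "trek_source \<tau> = a" "trek_target \<tau> = y"
    by (auto simp: \<tau>_def trek_source_def trek_target_def)
  moreover have "(left_set \<tau> \<union> right_set \<tau>) \<inter> L' = {}"
    using a_obs y_obs obs t no_L' by (auto simp: \<tau>_def left_set_def right_set_def)
  ultimately show ?thesis unfolding htr_def using y_obs a by blast
qed

text \<open>The reason why only the latent processes in \<open>L'\<close> confound \<open>Y\<close> with \<open>W \<union> {v}\<close>.  For \<open>y \<in> Y_htr\<close> the effect on
\<open>y\<close> is direct; as \<open>a \<noteq> y\<close>, a vertex \<open>t\<close> with direct effects on both is a common latent parent and hence in \<open>L'\<close>.  For any other \<open>y\<close> a nonzero total effect on
\<open>y\<close> means a directed path from \<open>t\<close> to \<open>y\<close>, and with the edge from \<open>t\<close> to \<open>a\<close> (or with \<open>t = a\<close>) a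
half-trek from \<open>a\<close> to \<open>y\<close> that avoids \<open>L'\<close>.\<close>

lemma direct_mult_mixed_eq_0:
  assumes "linked_graph Ob La D h" and a: "a \<in> W \<union> {v}" and y: "y \<in> Y" and t: "t \<notin> L'"
  shows "direct_effects Ob La h $ t $ a = 0 \<or> mixed_effects Ob La Y_htr h $ t $ y = 0"
proof (rule ccontr)
  interpret linked_graph Ob La D h by fact
  assume "\<not> ?thesis"
  then have *: "direct $ t $ a \<noteq> 0" "mixed_effects Ob La Y_htr h $ t $ y \<noteq> 0" by auto
  have "y \<in> Ob" "a \<noteq> y" using a y Y Y_W by auto
  have t_cases: "t = a \<or> t \<in> La - L' \<and> (t, a) \<in> D"
    using *(1) t links vertices by (auto simp: direct_nth split: if_splits)
  show False
  proof (cases "y \<in> htr Ob La D L' (W \<union> {v})")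
    case True
    then have "direct $ t $ y \<noteq> 0" using *(2) y by (simp add: mixed_effects_def Y_htr_def)
    then have "t \<in> La" "(t, y) \<in> D"
      using t_cases \<open>a \<noteq> y\<close> \<open>y \<in> Ob\<close> a v W vertices links by (auto simp: direct_nth split: if_splits)
    then have "t \<in> parents_in D La Y \<inter> parents_in D La (W \<union> {v})"
      using t_cases a y v W vertices by (auto simp: parents_in_def)
    then show False using common_latent t by blast
  next
    case False
    have "{(u, w). h $ u $ w \<noteq> 0} \<subseteq> D" using links by auto
    then have "(t, y) \<in> D\<^sup>*" using mixed_support[OF *(2)] rtrancl_mono by blast
    then show False using reachable_in_htr[OF a y t_cases] False by blast
  qed
qed

text \<open>The spectrum after the links into \<open>W\<close> have been undone on the left and those into \<open>Y_htr\<close> on the right,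
written in terms of the parameters.\<close>

definition transformed_spectrum :: "ratfun^'v^'v \<Rightarrow> ('v \<Rightarrow> ratfun) \<Rightarrow> 'v \<Rightarrow> 'v \<Rightarrow> ratfun" where
  "transformed_spectrum h s j y =
     (\<Sum>t\<in>UNIV. mixed_effects Ob La W h $ t $ j * s t * star (mixed_effects Ob La Y_htr h $ t $ y))"

abbreviation "W_matrix h \<equiv> embed_matrix W (\<lambda>w w'. direct_effects Ob La h $ apex (origin w) $ w')"
abbreviation "system_matrix M \<equiv> embed_matrix Y (\<lambda>y y'. M (target y') y)"

text \<open>Row \<open>v\<close> of the transformed spectrum is a combination of the rows in \<open>pa \<union> W\<close>.  The rows at \<open>x \<in> pa\<close> enter with
the wanted links \<open>h\<^sub>x\<^sub>v\<close> by the recursion for total effects; the remaining direct effects on \<open>v\<close> matter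
only for the sources in \<open>L'\<close>, where they are a combination \<open>\<psi>\<close> of the direct effects on \<open>W\<close>.\<close>

lemma transformed_spectrum_solution:
  assumes h: "linked_graph Ob La D h" and det_W: "det (W_matrix h) \<noteq> 0"
  shows "\<exists>c. (\<forall>y\<in>Y. (\<Sum>y'\<in>Y. transformed_spectrum h s (target y') y * c y')
                        = transformed_spectrum h s v y) \<and>
             (\<forall>x\<in>pa. c (origin x) = h $ x $ v)"
proof -
  interpret linked_graph Ob La D h by fact
  let ?M = "transformed_spectrum h s" and ?m = "mixed_effects Ob La Y_htr h"
  define \<psi> where "\<psi> = cramer_solution W (\<lambda>w w'. direct $ apex (origin w) $ w')
    (\<lambda>w. direct $ apex (origin w) $ v)"
  have "\<forall>w\<in>W. (\<Sum>w'\<in>W. direct $ apex (origin w) $ w' * \<psi> w') = direct $ apex (origin w) $ v"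
    unfolding cramer_solution_iff[OF det_W] by (simp add: \<psi>_def)
  then have L'_case: "direct $ l $ v = (\<Sum>w\<in>W. direct $ l $ w * \<psi> w)" if "l \<in> L'" for l
    using that tops_of_W by auto
  have direct_v: "direct $ t $ v * star (?m $ t $ y)
      = (\<Sum>w\<in>W. direct $ t $ w * \<psi> w) * star (?m $ t $ y)" if "y \<in> Y" for t y
  proof (cases "t \<in> L'")
    case False
    have "direct $ t $ a * star (?m $ t $ y) = 0" if "a \<in> W \<union> {v}" for a
      using direct_mult_mixed_eq_0[OF h that \<open>y \<in> Y\<close> False] by auto
    then have "direct $ t $ v * star (?m $ t $ y) = 0"
      "direct $ t $ w * \<psi> w * star (?m $ t $ y) = 0" if "w \<in> W" for w
      using that by fastforce+
    then show ?thesis unfolding sum_distrib_right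
      using \<open>\<And>a. a \<in> W \<union> {v} \<Longrightarrow> direct $ t $ a * star (?m $ t $ y) = 0\<close>[of v]
      by (simp add: sum.neutral)
  qed (simp add: L'_case)
  have M_v: "?M v y = (\<Sum>w\<in>W. ?M w y * \<psi> w) + (\<Sum>x\<in>pa. ?M x y * h $ x $ v)" if y: "y \<in> Y" for y
  proof -
    have "?M v y = (\<Sum>t\<in>UNIV. (direct $ t $ v * star (?m $ t $ y)) * s t
        + (\<Sum>x\<in>pa. tot $ t $ x * h $ x $ v) * s t * star (?m $ t $ y))"
      using W unfolding transformed_spectrum_def
      by (intro sum.cong) (auto simp: mixed_effects_def total_nth[of _ v] algebra_simps)
    also have "\<dots> = (\<Sum>t\<in>UNIV. \<Sum>w\<in>W. direct $ t $ w * s t * star (?m $ t $ y) * \<psi> w)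
        + (\<Sum>t\<in>UNIV. \<Sum>x\<in>pa. tot $ t $ x * s t * star (?m $ t $ y) * h $ x $ v)"
      unfolding direct_v[OF y] sum.distrib
      by (simp add: sum_distrib_right sum_distrib_left mult_ac)
    also have "(\<Sum>t\<in>UNIV. \<Sum>w\<in>W. direct $ t $ w * s t * star (?m $ t $ y) * \<psi> w) = (\<Sum>w\<in>W. ?M w y * \<psi> w)"
      by (subst sum.swap) (simp add: transformed_spectrum_def mixed_effects_def sum_distrib_right)
    also have "(\<Sum>t\<in>UNIV. \<Sum>x\<in>pa. tot $ t $ x * s t * star (?m $ t $ y) * h $ x $ v)
        = (\<Sum>x\<in>pa. ?M x y * h $ x $ v)"
    proof (subst sum.swap, rule sum.cong)
      fix x assume "x \<in> pa"
      then have "x \<notin> W" using W_parents by blast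
      then show "(\<Sum>t\<in>UNIV. tot $ t $ x * s t * star (?m $ t $ y) * h $ x $ v) = ?M x y * h $ x $ v"
        by (simp add: transformed_spectrum_def mixed_effects_def[of _ _ W] sum_distrib_right)
    qed simp
    finally show ?thesis .
  qed
  let ?c = "\<lambda>j. if j \<in> W then \<psi> j else h $ j $ v"
  have "(\<Sum>y'\<in>Y. ?M (target y') y * ?c (target y')) = ?M v y" if "y \<in> Y" for y
  proof -
    have "(\<Sum>y'\<in>Y. ?M (target y') y * ?c (target y')) = (\<Sum>j\<in>pa \<union> W. ?M j y * ?c j)"
      by (rule sum.reindex_bij_betw[OF targets])
    also have "\<dots> = (\<Sum>j\<in>pa. ?M j y * ?c j) + (\<Sum>j\<in>W. ?M j y * ?c j)"
      using W_parents by (intro sum.union_disjoint) auto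
    also have "(\<Sum>j\<in>pa. ?M j y * ?c j) = (\<Sum>x\<in>pa. ?M x y * h $ x $ v)"
      using W_parents by (intro sum.cong) auto
    finally show ?thesis using M_v[OF that] by simp
  qed
  moreover have "?c (target (origin x)) = h $ x $ v" if "x \<in> pa" for x
    using that W_parents origin(2)[of x] by auto
  ultimately show ?thesis by (intro exI[of _ "\<lambda>y. ?c (target y)"]) blast
qed

text \<open>The links carried by \<open>\<theta>1\<close> are the edges of the Left paths and those carried by \<open>\<theta>2\<close> the edges of the Right paths.
Both have the variances \<open>\<omega>\<close>, supported on the tops, and so does every parameter on the segment between them.
There the sum over all vertices in the transformed spectrum reduces to a sum over the half-treks, and the
system matrix factors into square matrices.  At \<open>\<theta>2\<close> the matrix \<open>W_matrix\<close> is diagonal as well, because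
the Right paths that end in \<open>W\<close> are single edges.\<close>

lemma generic_solvable:
  assumes E: "E \<in> ts_graphs_of D"
  shows "generic Ob E (\<lambda>\<theta>. det (W_matrix (link_matrix E \<theta>)) \<noteq> 0)"
    and "generic Ob E (\<lambda>\<theta>. det (system_matrix
      (transformed_spectrum (link_matrix E \<theta>) (\<lambda>t. internal_spectrum E \<theta> $ t $ t))) \<noteq> 0)"
proof -
  note ts = E[unfolded ts_graphs_of_def, simplified]
  let ?K = "semistable_params Ob E"
  let ?h = "link_matrix E" and ?s = "\<lambda>\<theta> t. internal_spectrum E \<theta> $ t $ t"
  let ?mW = "\<lambda>\<theta>. mixed_effects Ob La W (?h \<theta>)" and ?mY = "\<lambda>\<theta>. mixed_effects Ob La Y_htr (?h \<theta>)"
  define \<omega> :: "'v \<Rightarrow> real" where "\<omega> u = of_bool (u \<in> (\<lambda>y. apex y) ` Y)" for u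
  have \<omega>: "\<omega> u \<ge> 0" for u by (simp add: \<omega>_def)
  let ?left = "\<Union>y\<in>Y. path_edges (Lf y)" and ?right = "\<Union>y\<in>Y. path_edges (Rt y)"
  have edges: "?left \<subseteq> process_graph E" "?right \<subseteq> process_graph E"
    using directed_path_edges left_path right_path ts by blast+
  obtain \<theta>1 where \<theta>1: "\<theta>1 \<in> ?K" "snd \<theta>1 = \<omega>" "\<And>u w. ?h \<theta>1 $ u $ w \<noteq> 0 \<longleftrightarrow> (u, w) \<in> ?left"
    using exists_params_with_links[of E ?left \<omega> Ob] ts edges \<omega> by blast
  obtain \<theta>2 where \<theta>2: "\<theta>2 \<in> ?K" "snd \<theta>2 = \<omega>" "\<And>u w. ?h \<theta>2 $ u $ w \<noteq> 0 \<longleftrightarrow> (u, w) \<in> ?right"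
    using exists_params_with_links[of E ?right \<omega> Ob] ts edges \<omega> by blast
  note linked = linked_graph_link_matrix[OF E]
  have left: "?mY \<theta>1 $ apex i $ y \<noteq> 0 \<longleftrightarrow> y = i" if "i \<in> Y" "y \<in> Y" for i y
  proof -
    have "mixed_effects Ob La Y_htr (?h \<theta>1) $ hd (Lf i) $ last (Lf y) \<noteq> 0 \<longleftrightarrow> i = y"
      by (rule linked_graph.disjoint_paths_effects[OF linked])
        (use that left_path left_disjoint \<theta>1(3) left_form left_last Y in auto)
    then show ?thesis using left_last[OF that(2)] by auto
  qed
  have right: "mixed_effects Ob La W (?h \<theta>2) $ apex i $ target j \<noteq> 0 \<longleftrightarrow> i = j"
    if "i \<in> Y" "j \<in> Y" for i j
  proof -
    have "target j \<in> W \<Longrightarrow> \<exists>l\<in>La. Rt j = [l, target j]"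
      using right_form[OF that(2)] L' by blast
    then have "mixed_effects Ob La W (?h \<theta>2) $ hd (Rt i) $ last (Rt j) \<noteq> 0 \<longleftrightarrow> i = j"
      by (intro linked_graph.disjoint_paths_effects[OF linked, where I = Y])
        (use that right_path right_disjoint \<theta>2(3) target_observed in auto)
    then show ?thesis using same_top[OF that(1)] by simp
  qed
  let ?G1 = "\<lambda>\<theta>. det (embed_matrix Y (\<lambda>y i. star (?mY \<theta> $ apex i $ y)))"
  let ?G2 = "\<lambda>\<theta>. det (embed_matrix Y (\<lambda>i j. ?mW \<theta> $ apex i $ target j))"
  have param_rational_embed: "param_rational Ob E (\<lambda>\<theta>. det (embed_matrix I (g \<theta>)))"
    if "\<And>i j. param_rational Ob E (\<lambda>\<theta>. g \<theta> i j)" for I and g :: "'v params \<Rightarrow> 'v \<Rightarrow> 'v \<Rightarrow> ratfun"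
  proof (rule param_rational_det)
    fix i j
    show "param_rational Ob E (\<lambda>\<theta>. embed_matrix I (g \<theta>) $ i $ j)"
      using that by (cases "i \<in> I \<and> j \<in> I") (auto simp: embed_matrix_def param_rational.const)
  qed
  note rational = param_rational_mixed[OF E] param_rational_direct[OF E] param_rational_star
    param_rational_embed param_rational.mult param_rational_sum
    param_rational_internal_spectrum[OF conjunct1[OF ts]]

  show "generic Ob E (\<lambda>\<theta>. det (W_matrix (?h \<theta>)) \<noteq> 0)"
  proof (rule generic_nonzero[OF _ \<theta>2(1)])
    show "det (W_matrix (?h \<theta>2)) \<noteq> 0"
    proof (rule det_embed_matrix_diagonal)
      fix w w' assume *: "w \<in> W" "w' \<in> W"
      then have "?mW \<theta>2 $ apex (origin w) $ target (origin w') \<noteq> 0 \<longleftrightarrow> origin w = origin w'"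
        using origin by (intro right) auto
      moreover have "origin w = origin w' \<longleftrightarrow> w = w'"
        using * origin(2) by (metis UnI2)
      ultimately show "direct_effects Ob La (?h \<theta>2) $ apex (origin w) $ w' \<noteq> 0 \<longleftrightarrow> w = w'"
        using * origin(2)[of w'] by (simp add: mixed_effects_def)
    qed
  qed (intro rational)

  have G1: "param_rational Ob E ?G1" and G2: "param_rational Ob E ?G2" by (intro rational)+
  have "?G1 \<theta>1 \<noteq> 0"
    using left by (intro det_embed_matrix_diagonal) simp
  moreover have "?G2 \<theta>2 \<noteq> 0"
    using right by (intro det_embed_matrix_diagonal)
  ultimately obtain r where r: "param_segment \<theta>1 \<theta>2 r \<in> ?K"
    "?G1 (param_segment \<theta>1 \<theta>2 r) \<noteq> 0" "?G2 (param_segment \<theta>1 \<theta>2 r) \<noteq> 0"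
    using param_rationals_nonzero_on_segment[OF G1 \<theta>1(1) _ G2 \<theta>2(1)] by blast
  define \<theta> where "\<theta> = param_segment \<theta>1 \<theta>2 r"
  have s: "?s \<theta> t \<noteq> 0 \<longleftrightarrow> t \<in> (\<lambda>y. apex y) ` Y" for t
    using internal_spectrum_eq_0_iff[of E \<theta> Ob t] ts r(1) \<theta>1(2) \<theta>2(2)
    by (auto simp: \<theta>_def param_segment_def \<omega>_def algebra_simps)
  let ?M = "\<lambda>\<theta>. transformed_spectrum (?h \<theta>) (?s \<theta>)"
  have M: "?M \<theta> j y = (\<Sum>i\<in>Y. \<Sum>k\<in>Y. star (?mY \<theta> $ apex i $ y) * (if i = k then ?s \<theta> (apex i) else 0)
              * ?mW \<theta> $ apex k $ j)" for j y
  proof -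
    have "?M \<theta> j y = (\<Sum>t\<in>(\<lambda>y. apex y) ` Y. ?mW \<theta> $ t $ j * ?s \<theta> t * star (?mY \<theta> $ t $ y))"
      unfolding transformed_spectrum_def using s by (intro sum.mono_neutral_right) auto
    also have "\<dots> = (\<Sum>i\<in>Y. star (?mY \<theta> $ apex i $ y) * ?s \<theta> (apex i) * ?mW \<theta> $ apex i $ j)"
      by (subst sum.reindex[OF top_inj]) (simp add: mult_ac)
    also have "\<dots> = (\<Sum>i\<in>Y. \<Sum>k\<in>Y. star (?mY \<theta> $ apex i $ y) * (if i = k then ?s \<theta> (apex i) else 0)
              * ?mW \<theta> $ apex k $ j)"
      by (intro sum.cong) (simp_all add: if_distrib if_distribR cong: if_cong)
    finally show ?thesis .
  qed
  have "system_matrix (?M \<theta>) = embed_matrix Y (\<lambda>y i. star (?mY \<theta> $ apex i $ y))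
      ** (embed_matrix Y (\<lambda>i k. if i = k then ?s \<theta> (apex i) else 0)
      ** embed_matrix Y (\<lambda>k j. ?mW \<theta> $ apex k $ target j))"
    unfolding embed_matrix_mult M by (simp add: sum_distrib_left mult.assoc)
  moreover have "det (embed_matrix Y (\<lambda>i k. if i = k then ?s \<theta> (apex i) else 0)) \<noteq> 0"
    using s by (intro det_embed_matrix_diagonal) auto
  ultimately have "det (system_matrix (?M \<theta>)) \<noteq> 0"
    using r(2,3) by (simp add: det_mul \<theta>_def)
  moreover have "param_rational Ob E (\<lambda>\<theta>. det (system_matrix (?M \<theta>)))"
    unfolding transformed_spectrum_def by (intro rational)
  ultimately show "generic Ob E (\<lambda>\<theta>. det (system_matrix (?M \<theta>)) \<noteq> 0)"
    using generic_nonzero r(1) \<theta>_def by blast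
qed

text \<open>Entries of \<open>undo_links\<close> with the links replaced by given estimates \<open>X\<close>, of which only the values on links into
\<open>B\<close> are looked up.\<close>

definition link_correction :: "'v set \<Rightarrow> ('v \<Rightarrow> 'v \<Rightarrow> ratfun) \<Rightarrow> 'v \<Rightarrow> 'v \<Rightarrow> ratfun" where
  "link_correction B X u w = of_bool (u = w) - (if w \<in> B \<and> (u, w) \<in> D then X u w else 0)"

text \<open>The counterpart of \<open>transformed_spectrum\<close> that can be computed from an observed spectrum \<open>S\<close>.  The estimates
\<open>X'\<close> on the right are estimates of starred links.\<close>

definition corrected_spectrum ::
    "('v \<Rightarrow> 'v \<Rightarrow> ratfun) \<Rightarrow> ('v \<Rightarrow> 'v \<Rightarrow> ratfun) \<Rightarrow> ratfun^'v^'v \<Rightarrow> 'v \<Rightarrow> 'v \<Rightarrow> ratfun" where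
  "corrected_spectrum X X' S j y =
     (\<Sum>b\<in>Ob. \<Sum>c\<in>Ob. link_correction W X b j * S $ b $ c * link_correction Y_htr X' c y)"

lemma corrected_spectrum_observed:
  assumes E: "E \<in> ts_graphs_of D" and j: "j \<in> Ob" and y: "y \<in> Ob"
    and X: "\<And>u w. u \<in> Ob \<Longrightarrow> w \<in> W \<Longrightarrow> (u, w) \<in> D \<Longrightarrow> X u w = link_matrix E \<theta> $ u $ w"
    and X': "\<And>u w. u \<in> Ob \<Longrightarrow> w \<in> Y_htr \<Longrightarrow> (u, w) \<in> D \<Longrightarrow> X' u w = star (link_matrix E \<theta> $ u $ w)"
  shows "corrected_spectrum X X' (observed_spectrum Ob La E \<theta>) j y
       = transformed_spectrum (link_matrix E \<theta>) (\<lambda>t. internal_spectrum E \<theta> $ t $ t) j y"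
proof -
  let ?h = "link_matrix E \<theta>" and ?S = "observed_spectrum Ob La E \<theta>" and ?s = "internal_spectrum E \<theta>"
  interpret linked_graph Ob La D ?h by (rule linked_graph_link_matrix[OF E])
  have undo: "link_correction W X b j = undo_links Ob W ?h $ b $ j"
    "link_correction Y_htr X' b y = star (undo_links Ob Y_htr ?h $ b $ y)" if "b \<in> Ob" for b
    using X[of b j] X'[of b y] that j y links[of b j] links[of b y]
    by (auto simp: link_correction_def undo_links_def submat_def)
  have outside: "undo_links Ob B ?h $ b $ w = 0" if "b \<notin> Ob" "w \<in> Ob" for B b w
    using that by (auto simp: undo_links_def submat_def)
  have "transformed_spectrum ?h (\<lambda>t. ?s $ t $ t) j y
      = (transpose (tot ** undo_links Ob W ?h) ** ?s ** map_matrix star (tot ** undo_links Ob Y_htr ?h)) $ j $ y"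
    unfolding total_undo_links
    by (subst transpose_mult_diagonal_mult)
      (simp_all add: internal_spectrum_def transformed_spectrum_def)
  also have "\<dots> = (transpose (undo_links Ob W ?h) ** (?S ** map_matrix star (undo_links Ob Y_htr ?h))) $ j $ y"
    unfolding observed_spectrum_factorization[OF E]
    by (simp add: matrix_transpose_mul map_matrix_star_mult matrix_mul_assoc)
  also have "\<dots> = (\<Sum>b\<in>UNIV. \<Sum>c\<in>UNIV. undo_links Ob W ?h $ b $ j * ?S $ b $ c
        * star (undo_links Ob Y_htr ?h $ c $ y))"
    by (simp add: matrix_matrix_mult_def transpose_def sum_distrib_left mult.assoc)
  also have "\<dots> = (\<Sum>b\<in>Ob. \<Sum>c\<in>UNIV. undo_links Ob W ?h $ b $ j * ?S $ b $ c
        * star (undo_links Ob Y_htr ?h $ c $ y))"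
    using outside[OF _ j] by (intro sum.mono_neutral_right) auto
  also have "\<dots> = (\<Sum>b\<in>Ob. \<Sum>c\<in>Ob. undo_links Ob W ?h $ b $ j * ?S $ b $ c
        * star (undo_links Ob Y_htr ?h $ c $ y))"
    using outside[OF _ y] by (intro sum.cong sum.mono_neutral_right) auto
  finally show ?thesis by (simp add: corrected_spectrum_def undo)
qed

text \<open>The expression for the link is Cramer's rule applied to the corrected spectrum, with the given
expressions for the links into \<open>W\<close> and their swapped versions for the starred links into \<open>Y_htr\<close>.  It is valid
outside of the union of the exceptional sets of these links and of the zero sets of the two determinants.\<close>

lemma parents_rationally_identifiable:
  assumes identifiable: "\<And>u w. u \<in> Ob \<Longrightarrow> w \<in> Ob \<Longrightarrow> (u, w) \<in> D \<Longrightarrow> w \<in> W \<union> (Y \<inter> htr Ob La D L' (W \<union> {v})) \<Longrightarrow>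
      rationally_identifiable Ob La D u w"
    and x: "x \<in> pa"
  shows "rationally_identifiable Ob La D x v"
proof -
  define I where "I = {(u, w). u \<in> Ob \<and> w \<in> W \<union> Y_htr \<and> (u, w) \<in> D}"
  define expresses where "expresses e \<psi> \<longleftrightarrow> entries \<psi> \<subseteq> Ob \<times> Ob \<and>
    (\<forall>E\<in>ts_graphs_of D. generic Ob E (\<lambda>\<theta>.
      ratexpr_defined \<psi> (observed_spectrum Ob La E \<theta>) \<and>
      ratexpr_val \<psi> (observed_spectrum Ob La E \<theta>) = link_matrix E \<theta> $ fst e $ snd e))" for e \<psi>
  have "\<forall>e\<in>I. \<exists>\<psi>. expresses e \<psi>"
    using identifiable W Y
    unfolding rationally_identifiable_def expresses_def generic_iff_proper_algebraic_subset
    by (auto simp: I_def Y_htr_def)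
  then obtain \<Psi> where "\<forall>e\<in>I. expresses e (\<Psi> e)" using bchoice by blast
  then have \<Psi>: "\<And>e. e \<in> I \<Longrightarrow> entries (\<Psi> e) \<subseteq> Ob \<times> Ob"
    "\<And>e E. e \<in> I \<Longrightarrow> E \<in> ts_graphs_of D \<Longrightarrow> generic Ob E (\<lambda>\<theta>.
      ratexpr_defined (\<Psi> e) (observed_spectrum Ob La E \<theta>) \<and>
      ratexpr_val (\<Psi> e) (observed_spectrum Ob La E \<theta>) = link_matrix E \<theta> $ fst e $ snd e)"
    by (simp_all add: expresses_def)
  define X where "X S u w = ratexpr_val (\<Psi> (u, w)) S" for S u w
  define X' where "X' S u w = ratexpr_val (swap_entries (\<Psi> (u, w))) S" for S u w
  define M where "M S = corrected_spectrum (X S) (X' S) S" for S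
  define \<M> where "\<M> = {S. (\<forall>e\<in>I. ratexpr_defined (\<Psi> e) S \<and> ratexpr_defined (swap_entries (\<Psi> e)) S)
    \<and> det (system_matrix (M S)) \<noteq> 0}"
  have comp_X: "computable_on Ob \<M> (\<lambda>S. link_correction W (X S) u w)" if "u \<in> Ob" for u w
  proof (cases "w \<in> W \<and> (u, w) \<in> D")
    case True
    then have "(u, w) \<in> I" using that by (auto simp: I_def)
    then have "computable_on Ob \<M> (\<lambda>S. X S u w)"
      using \<Psi>(1) by (intro computable_onI[of "\<Psi> (u, w)"]) (auto simp: \<M>_def X_def)
    then have "computable_on Ob \<M> (\<lambda>S. of_bool (u = w) - X S u w)"
      by (intro computable_on_diff) (cases "u = w"; simp add: computable)
    then show ?thesis using True by (simp add: link_correction_def)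
  qed (cases "u = w", auto simp: link_correction_def intro: computable)
  have comp_X': "computable_on Ob \<M> (\<lambda>S. link_correction Y_htr (X' S) u w)" if "u \<in> Ob" for u w
  proof (cases "w \<in> Y_htr \<and> (u, w) \<in> D")
    case True
    then have "(u, w) \<in> I" using that by (auto simp: I_def)
    then have "computable_on Ob \<M> (\<lambda>S. X' S u w)"
      using \<Psi>(1)[of "(u, w)"] by (intro computable_onI[of "swap_entries (\<Psi> (u, w))"])
        (auto simp: \<M>_def X'_def entries_swap_entries)
    then have "computable_on Ob \<M> (\<lambda>S. of_bool (u = w) - X' S u w)"
      by (intro computable_on_diff) (cases "u = w"; simp add: computable)
    then show ?thesis using True by (simp add: link_correction_def)
  qed (cases "u = w", auto simp: link_correction_def intro: computable)
  have comp_M: "computable_on Ob \<M> (\<lambda>S. M S j y)" for j y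
    unfolding M_def corrected_spectrum_def
    by (intro computable_on_sum computable_on_mult comp_X comp_X' computable_on_entry)
  have comp_system: "computable_on Ob \<M> (\<lambda>S. system_matrix (M S) $ i $ j)" for i j
    using comp_M by (cases "i \<in> Y \<and> j \<in> Y"; cases "i = j") (auto simp: embed_matrix_def intro: computable)
  let ?solution = "\<lambda>S. cramer_solution Y (\<lambda>y y'. M S (target y') y) (M S v) (origin x)"
  have "computable_on Ob \<M> ?solution"
    unfolding cramer_solution_def
  proof (intro computable_on_divide computable_on_det comp_system)
    fix i j
    show "computable_on Ob \<M> (\<lambda>S. (\<chi> i j. if j = origin x then if i \<in> Y then M S v i else 0
        else system_matrix (M S) $ i $ j) $ i $ j)"
      using comp_M comp_system[of i j] by (cases "j = origin x"; cases "i \<in> Y") (auto intro: computable)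
  qed (simp add: \<M>_def)
  then obtain \<psi> where \<psi>: "entries \<psi> \<subseteq> Ob \<times> Ob"
    "\<And>S. S \<in> \<M> \<Longrightarrow> ratexpr_defined \<psi> S \<and> ratexpr_val \<psi> S = ?solution S"
    unfolding computable_on_def by blast
  have "generic Ob E (\<lambda>\<theta>. ratexpr_defined \<psi> (observed_spectrum Ob La E \<theta>) \<and>
      ratexpr_val \<psi> (observed_spectrum Ob La E \<theta>) = link_matrix E \<theta> $ x $ v)"
    if E: "E \<in> ts_graphs_of D" for E
  proof -
    obtain \<theta>0 where "\<theta>0 \<in> semistable_params Ob E"
      using exists_params_with_links[of E "{}" "\<lambda>_. 0" Ob] E by (auto simp: ts_graphs_of_def)
    then have "generic Ob E (\<lambda>\<theta>. \<forall>e\<in>I. ratexpr_defined (\<Psi> e) (observed_spectrum Ob La E \<theta>) \<and>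
      ratexpr_val (\<Psi> e) (observed_spectrum Ob La E \<theta>) = link_matrix E \<theta> $ fst e $ snd e)"
      by (rule generic_Ball) (use \<Psi>(2) E in auto)
    from generic_conj[OF this generic_conj[OF generic_solvable[OF E]]] show ?thesis
    proof (rule generic_mono, elim conjE)
      fix \<theta>
      let ?S = "observed_spectrum Ob La E \<theta>" and ?h = "link_matrix E \<theta>"
      let ?T = "transformed_spectrum ?h (\<lambda>t. internal_spectrum E \<theta> $ t $ t)"
      assume I: "\<forall>e\<in>I. ratexpr_defined (\<Psi> e) ?S \<and> ratexpr_val (\<Psi> e) ?S = ?h $ fst e $ snd e"
        and det_W: "det (W_matrix ?h) \<noteq> 0" and det_T: "det (system_matrix ?T) \<noteq> 0"
      have swap: "ratexpr_defined (swap_entries (\<Psi> e)) ?S \<and>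
          ratexpr_val (swap_entries (\<Psi> e)) ?S = star (?h $ fst e $ snd e)" if "e \<in> I" for e
        using I that by (simp add: ratexpr_swap_entries ratexpr_star flip: observed_spectrum_star[OF E])
      have X: "X ?S u w = ?h $ u $ w" "X' ?S u w = star (?h $ u $ w)" if "(u, w) \<in> I" for u w
        using I swap that by (force simp: X_def X'_def)+
      have M: "M ?S j y = ?T j y" if "j \<in> Ob" "y \<in> Ob" for j y
        unfolding M_def by (rule corrected_spectrum_observed[OF E that]) (auto simp: X I_def)
      have M_target: "M ?S (target y') y = ?T (target y') y" "M ?S v y = ?T v y"
        if "y \<in> Y" "y' \<in> Y" for y y'
        using that M target_observed v Y by blast+
      have system: "system_matrix (M ?S) = system_matrix ?T"
        using M_target by (auto simp: embed_matrix_def vec_eq_iff)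
      then have "?S \<in> \<M>" using I swap det_T by (auto simp: \<M>_def)
      moreover have "?solution ?S = ?h $ x $ v"
      proof -
        obtain c where c: "\<forall>y\<in>Y. (\<Sum>y'\<in>Y. ?T (target y') y * c y') = ?T v y"
          "\<forall>x\<in>pa. c (origin x) = ?h $ x $ v"
          using transformed_spectrum_solution[OF linked_graph_link_matrix[OF E] det_W] by blast
        have "det (system_matrix (M ?S)) \<noteq> 0" using det_T system by simp
        moreover have "\<forall>y\<in>Y. (\<Sum>y'\<in>Y. M ?S (target y') y * c y') = M ?S v y"
          using c(1) M_target by simp
        ultimately have "\<forall>k\<in>Y. c k = cramer_solution Y (\<lambda>y y'. M ?S (target y') y) (M ?S v) k"
          by (rule iffD1[OF cramer_solution_iff])
        then show ?thesis using c(2) x origin(1)[of x] by auto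
      qed
      ultimately show "ratexpr_defined \<psi> ?S \<and> ratexpr_val \<psi> ?S = ?h $ x $ v"
        using \<psi>(2) by simp
    qed
  qed
  then show ?thesis
    unfolding rationally_identifiable_def generic_iff_proper_algebraic_subset using \<psi>(1) by blast
qed

end

theorem theorem5:
  fixes Ob La :: "'v::finite set" and D :: "('v \<times> 'v) set"
    and v :: 'v and Y W L' :: "'v set"
  assumes "exogenous_latent_graph Ob La D"
    and "acyclic D"
    and "v \<in> Ob"
    and "Y \<subseteq> Ob - {v}" and "W \<subseteq> Ob - {v}" and "L' \<subseteq> La"
    and "lf_htc Ob La D v Y W L'"
    and "\<And>u y. u \<in> Ob \<Longrightarrow> y \<in> Ob \<Longrightarrow> (u, y) \<in> D \<Longrightarrow>
           y \<in> W \<union> (Y \<inter> htr Ob La D L' (W \<union> {v})) \<Longrightarrow>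
           rationally_identifiable Ob La D u y"
  shows "\<forall>x\<in>parents_in D Ob {v}. rationally_identifiable Ob La D x v"
proof
  fix x assume x: "x \<in> parents_in D Ob {v}"
  obtain Lf Rt where "half_trek_system Ob La D v Y W L' Lf Rt"
    using lf_htc_half_trek_system[OF assms(1-7)] by blast
  then show "rationally_identifiable Ob La D x v"
    by (rule half_trek_system.parents_rationally_identifiable[OF _ assms(8) x])
qed

end
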